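(* Let $q$ be a prime power and $n\ge1$. Let $S_n$ be the set of monic polynomials of degree $n$ in $\mathbb{F}_q[X]$ with nonzero constant term, $\mathcal{I}_k$ the set of monic irreducible polynomials of degree $k$ in $\mathbb{F}_q[X]$ with nonzero constant term, and $I_k=|\mathcal{I}_k|$. Let $\mathcal{M}_n$ be the family of subsets $R\subseteq S_n$ whose elements are pairwise coprime, $N_n=\max_{R\in\mathcal{M}_n}|R|$, and $\mathcal{T}_n=\{R\in\mathcal{M}_n:|R|=N_n\}$. Then $$N_n=I_n+\sum_{k=1}^{\lfloor n/2\rfloor}I_k,$$ which is therefore the maximum number of mutually orthogonal Latin squares generated by linear bipermutive cellular automata of diameter $n+1$ over $\mathbb{F}_q$. Moreover, for $A\subseteq S_n$, $A\in\mathcal{T}_n$ if and only if all of the following hold: (1) $A$ contains $\mathcal{I}_n$; (2) if $n$ is even, $A$ contains $\{g^2:g\in\mathcal{I}_{n/2}\}$; (3) for every $g\in\mathcal{I}_k$ with $k<n/2$ there exists a unique $f\in A$ with $g\mid f$, and this $f$ is either of the form $f=g^a$ with $a=n/k$, or of the form $f=g^bh$ where $bk<n/2$ and $h\in\mathcal{I}_{n-bk}$, in which case $h$ divides no other $f'\in A$.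
   Context: The Latin square generated by a linear bipermutive cellular automaton with local rule $f(x_0,\dots,x_n)=\sum_j a_jx_j$ ($a_0,a_n\ne0$) is the Cayley table of the map $\mathbb{F}_q^{n}\times\mathbb{F}_q^n\to\mathbb{F}_q^n$, $(x,y)\mapsto(f(z_0,\dots,z_n),f(z_1,\dots,z_{n+1}),\dots,f(z_{n-1},\dots,z_{2n-1}))$ where $z=x\|y$; such squares for two rules are orthogonal iff the polynomials $\sum_j a_jX^j$ are coprime, so (taking $a_n=1$) sets of mutually orthogonal such squares correspond to sets of pairwise coprime elements of $S_n$.
   Formalization: The "if" direction fails as stated (n=2, q=3, A=S_2 satisfies (1)-(3) but is not pairwise coprime); a fourth condition is added to the equivalence: if n is even, A contains no product gh with distinct g,h in I_{n/2}. *)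

theory Defs
  imports
    "HOL-Computational_Algebra.Polynomial"
    "HOL-Computational_Algebra.Factorial_Ring"
    "HOL-Library.FuncSet"
begin

(* The field F_q is a type 'a :: {finite, field} with q = CARD('a); q is then automatically a
   prime power. *)

definition monic_polys :: "nat \<Rightarrow> 'a::field poly set" where
  "monic_polys n = {p. degree p = n \<and> lead_coeff p = 1 \<and> coeff p 0 \<noteq> 0}"

definition irred_polys :: "nat \<Rightarrow> 'a::field poly set" where
  "irred_polys k = {p. degree p = k \<and> lead_coeff p = 1 \<and> coeff p 0 \<noteq> 0 \<and> irreducible p}"

definition coprime_families :: "nat \<Rightarrow> 'a::field poly set set" where
  "coprime_families n = {R. R \<subseteq> monic_polys n \<and> pairwise coprime R}"

(* Over a finite field the set under Max is finite, and it contains card {} = 0. *)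
definition max_coprime :: "'a::field itself \<Rightarrow> nat \<Rightarrow> nat" where
  "max_coprime _ n = Max (card ` (coprime_families n :: 'a poly set set))"

definition max_families :: "nat \<Rightarrow> 'a::field poly set set" where
  "max_families n = {R \<in> coprime_families n. card R = max_coprime TYPE('a) n}"

(* A square of order card X is given by its Cayley table X \<times> X \<rightarrow> X. *)
definition latin_square :: "'b set \<Rightarrow> ('b \<times> 'b \<Rightarrow> 'b) \<Rightarrow> bool" where
  "latin_square X L \<longleftrightarrow>
     (\<forall>x\<in>X. bij_betw (\<lambda>y. L (x, y)) X X) \<and> (\<forall>y\<in>X. bij_betw (\<lambda>x. L (x, y)) X X)"

definition orthogonal_squares ::
    "'b set \<Rightarrow> ('b \<times> 'b \<Rightarrow> 'b) \<Rightarrow> ('b \<times> 'b \<Rightarrow> 'b) \<Rightarrow> bool" where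
  "orthogonal_squares X L M \<longleftrightarrow> bij_betw (\<lambda>p. (L p, M p)) (X \<times> X) (X \<times> X)"

definition mols :: "'b set \<Rightarrow> ('b \<times> 'b \<Rightarrow> 'b) set \<Rightarrow> bool" where
  "mols X \<L> \<longleftrightarrow> (\<forall>L\<in>\<L>. latin_square X L) \<and> pairwise (orthogonal_squares X) \<L>"

definition vecs :: "nat \<Rightarrow> 'a list set" where
  "vecs n = {xs. length xs = n}"

(* The rule f(x_0,...,x_n) = a_0 x_0 + ... + a_n x_n, where as = [a_0,...,a_n]. *)
definition linear_rule :: "'a::field list \<Rightarrow> 'a list \<Rightarrow> 'a" where
  "linear_rule as xs = (\<Sum>j<length as. as ! j * xs ! j)"

(* Cellular automaton of diameter n + 1 without boundary conditions: the i-th output cell is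
   f(z_i,...,z_{i+n}), so m input cells yield m - n output cells. *)
definition ca_map :: "nat \<Rightarrow> ('a list \<Rightarrow> 'a) \<Rightarrow> 'a list \<Rightarrow> 'a list" where
  "ca_map n f z = map (\<lambda>i. f (take (n + 1) (drop i z))) [0..<length z - n]"

(* Restricting makes equality of functions the same as equality of Cayley tables. *)
definition ca_square :: "nat \<Rightarrow> ('a list \<Rightarrow> 'a) \<Rightarrow> 'a list \<times> 'a list \<Rightarrow> 'a list" where
  "ca_square n f = restrict (\<lambda>(x, y). ca_map n f (x @ y)) (vecs n \<times> vecs n)"

definition linear_bipermutive_squares ::
    "nat \<Rightarrow> ('a::field list \<times> 'a list \<Rightarrow> 'a list) set" where
  "linear_bipermutive_squares n =
     {ca_square n (linear_rule as) | as. length as = n + 1 \<and> as ! 0 \<noteq> 0 \<and> as ! n \<noteq> 0}"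

definition max_linear_ca_mols :: "'a::field itself \<Rightarrow> nat \<Rightarrow> nat" where
  "max_linear_ca_mols _ n =
     Max (card ` {\<L>. \<L> \<subseteq> (linear_bipermutive_squares n :: ('a list \<times> 'a list \<Rightarrow> 'a list) set) \<and>
                      mols (vecs n) \<L>})"

definition contains_irreds :: "nat \<Rightarrow> 'a::field poly set \<Rightarrow> bool" where
  "contains_irreds n A \<longleftrightarrow> irred_polys n \<subseteq> A"

definition contains_squares :: "nat \<Rightarrow> 'a::field poly set \<Rightarrow> bool" where
  "contains_squares n A \<longleftrightarrow> (even n \<longrightarrow> {g ^ 2 | g. g \<in> irred_polys (n div 2)} \<subseteq> A)"

definition small_irreds_covered :: "nat \<Rightarrow> 'a::field poly set \<Rightarrow> bool" where
  "small_irreds_covered n A \<longleftrightarrow>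
     (\<forall>k. 2 * k < n \<longrightarrow> (\<forall>g \<in> irred_polys k.
        (\<exists>!f. f \<in> A \<and> g dvd f) \<and>
        (\<forall>f \<in> A. g dvd f \<longrightarrow>
           (k dvd n \<and> f = g ^ (n div k)) \<or>
           (\<exists>b h. 2 * (b * k) < n \<and> h \<in> irred_polys (n - b * k) \<and> f = g ^ b * h \<and>
                  (\<forall>f' \<in> A. h dvd f' \<longrightarrow> f' = f)))))"

(* The three conditions above do not exclude elements g * h of A with g, h distinct and
   irreducible of degree n/2, although these share a factor with the elements g^2 and h^2 of A.
   For instance, with n = 2 and more than two field elements, A = monic_polys 2 satisfies all
   three conditions but is not pairwise coprime. *)
definition no_mixed_products :: "nat \<Rightarrow> 'a::field poly set \<Rightarrow> bool" where
  "no_mixed_products n A \<longleftrightarrow>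
     (even n \<longrightarrow> (\<forall>g \<in> irred_polys (n div 2). \<forall>h \<in> irred_polys (n div 2). g \<noteq> h \<longrightarrow> g * h \<notin> A))"

end

(* A member of S_n is irreducible or has an irreducible factor of degree at most n/2. Choosing such
   a "key" factor for each member embeds a pairwise coprime family into the set B of monic irreducibles
   of degree n or at most n/2, whence N_n <= card B. Equality is attained by g |-> g, g^2 or g * i(g),
   according as deg g = n, deg g = n/2 or k = deg g < n/2, where i is an injection from I_k into
   I_(n-k). Such an injection exists because I_k is increasing in k. This follows from
   sum_{d | m} d M_d = q^m (M_d counts all monic irreducibles of degree d), obtained by summing
   deg f = sum_{P, j >= 1, P^j | f} deg P over all monic f of degree m. In a family of size card B each
   key factor divides exactly one member and each member has exactly one key factor, which is what
   the conditions (1)-(3) express.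

   For the squares, pair a configuration z with polynomials by z(X^i) = z_i. Then the outputs of the
   rule f are the values z(X^i f), and the joint map of the rules f and g is injective if f and g are
   coprime (Bezout), and fails to be surjective if they are not (a relation a f = b g with
   deg a, deg b < n constrains the outputs). *)

theory Submission
  imports Defs "HOL-Computational_Algebra.Polynomial_Factorial" "HOL-Library.Cardinality"
begin

section \<open>Irreducible factors of polynomials over a field\<close>

text \<open>Unlike in \<open>monic_polys\<close>, a zero constant term is allowed. All counting is
  done in this larger set, where it is exact; the polynomial \<open>X\<close> is removed only in
  \<open>card_irred_polys\<close>.\<close>

definition monics :: "nat \<Rightarrow> 'a::field poly set" where
  "monics n = {p. degree p = n \<and> lead_coeff p = 1}"

definition monic_irreds :: "nat \<Rightarrow> 'a::field poly set" where
  "monic_irreds n = {p \<in> monics n. irreducible p}"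

lemma irreducible_degree_pos: "irreducible p \<Longrightarrow> degree p > 0" for p :: "'a::field poly"
  using is_unit_iff_degree by (metis gr0I irreducible_def)

lemma irreducible_monic_dvd_eq:
  fixes p q :: "'a::field poly"
  assumes "irreducible p" "irreducible q" "lead_coeff p = 1" "lead_coeff q = 1" "p dvd q"
  shows "p = q"
proof -
  obtain c where c: "q = p * c" using assms(5) by (elim dvdE)
  then have "is_unit c"
    using assms(1,2) irreducible_not_unit irreducibleD by blast
  then obtain u where u: "c = [:u:]" by (auto simp: is_unit_poly_iff)
  then have "u = 1" using c assms(3,4) by (cases "u = 0") simp_all
  with u c show ?thesis by simp
qed

lemma monic_irreducible_divisor_exists:
  fixes p :: "'a::field poly"
  assumes "degree p > 0"
  obtains g where "irreducible g" "lead_coeff g = 1" "g dvd p"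
  using assms
proof (induction "degree p" arbitrary: p thesis rule: less_induct)
  case less
  show ?case
  proof (cases "irreducible p")
    case True
    let ?g = "smult (inverse (lead_coeff p)) p"
    have nz: "lead_coeff p \<noteq> 0" using less.prems(2) by auto
    have dv: "?g dvd p" using nz by (simp add: smult_dvd_iff)
    have "?g = [:inverse (lead_coeff p):] * p" by simp
    moreover have "is_unit [:inverse (lead_coeff p):]" using nz by (simp add: is_unit_pCons_iff)
    ultimately have "irreducible ?g" using True irreducible_mult_unit_left by metis
    moreover have "lead_coeff ?g = 1" using nz by simp
    ultimately show ?thesis using dv less.prems(1) by blast
  next
    case False
    have "p \<noteq> 0" using less.prems(2) by auto
    then have "\<not> is_unit p" using less.prems(2) is_unit_iff_degree[of p] by simp
    then obtain a b where ab: "p = a * b" "\<not> is_unit a" "\<not> is_unit b"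
      using False \<open>p \<noteq> 0\<close> by (auto simp: irreducible_def)
    then have nz: "a \<noteq> 0" "b \<noteq> 0" using \<open>p \<noteq> 0\<close> by auto
    then have d: "degree a > 0" "degree b > 0" using ab is_unit_iff_degree by auto
    have "degree a < degree p" using ab nz d by (simp add: degree_mult_eq)
    then obtain g where "irreducible g" "lead_coeff g = 1" "g dvd a"
      using less.hyps d(1) by blast
    then show ?thesis using less.prems(1) ab(1) by auto
  qed
qed

text \<open>A common divisor that is not a unit is nonzero because \<open>f\<close> is, so it has
  positive degree and hence a monic irreducible factor.\<close>

lemma coprime_iff_no_common_irreducible:
  fixes f g :: "'a::field poly"
  assumes "f \<noteq> 0"
  shows "coprime f g \<longleftrightarrow> (\<nexists>p. irreducible p \<and> lead_coeff p = 1 \<and> p dvd f \<and> p dvd g)"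
proof
  assume "coprime f g"
  then show "\<nexists>p. irreducible p \<and> lead_coeff p = 1 \<and> p dvd f \<and> p dvd g"
    by (meson coprime_common_divisor irreducible_not_unit)
next
  assume no: "\<nexists>p. irreducible p \<and> lead_coeff p = 1 \<and> p dvd f \<and> p dvd g"
  show "coprime f g"
  proof (rule ccontr)
    assume "\<not> coprime f g"
    then obtain c where c: "c dvd f" "c dvd g" "\<not> is_unit c" by (auto elim: not_coprimeE)
    then have "c \<noteq> 0" using assms by auto
    with c have "degree c > 0" using is_unit_iff_degree by auto
    then obtain p where "irreducible p" "lead_coeff p = 1" "p dvd c"
      by (rule monic_irreducible_divisor_exists)
    with no c show False by (meson dvd_trans)
  qed
qed

text \<open>A nonzero combination \<open>d\<close> of least degree divides every combination, since
  the remainder modulo \<open>d\<close> is again a combination, of smaller degree. So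
  \<open>d\<close> divides both \<open>f\<close> and \<open>g\<close> and is a unit.\<close>

lemma bezout_coprime_poly:
  fixes f g :: "'a::field poly"
  assumes "coprime f g"
  obtains u v where "u * f + v * g = 1"
proof -
  define S where "S = {(u, v). u * f + v * g \<noteq> 0}"
  have "f \<noteq> 0 \<or> g \<noteq> 0" using assms by auto
  then have "(1, 0) \<in> S \<or> (0, 1) \<in> S" by (auto simp: S_def)
  then obtain s where "s \<in> S" by blast
  then obtain t where t: "t \<in> S"
    and min: "\<And>t'. t' \<in> S \<Longrightarrow> degree (fst t * f + snd t * g) \<le> degree (fst t' * f + snd t' * g)"
    using ex_has_least_nat[of "\<lambda>t. t \<in> S" s "\<lambda>t. degree (fst t * f + snd t * g)"] by blast
  obtain u v where uv: "t = (u, v)" by force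
  define d where "d = u * f + v * g"
  have d0: "d \<noteq> 0" using t uv by (auto simp: S_def d_def)
  have div: "d dvd a * f + b * g" for a b
  proof (rule ccontr)
    define c where "c = a * f + b * g"
    assume "\<not> d dvd a * f + b * g"
    then have m: "c mod d \<noteq> 0" by (simp add: c_def dvd_eq_mod_eq_0)
    have "c mod d = (a - (c div d) * u) * f + (b - (c div d) * v) * g"
      by (simp add: c_def d_def minus_div_mult_eq_mod[symmetric] algebra_simps)
    then have "degree d \<le> degree (c mod d)"
      using min[of "(a - (c div d) * u, b - (c div d) * v)"] m uv by (simp add: S_def d_def)
    moreover have "degree (c mod d) < degree d" using degree_mod_less'[OF d0 m] .
    ultimately show False by simp
  qed
  have "d dvd f" "d dvd g" using div[of 1 0] div[of 0 1] by auto
  then have "is_unit d" using assms coprime_common_divisor by blast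
  then obtain e where "1 = d * e" by (elim dvdE)
  then have "(e * u) * f + (e * v) * g = 1" by (simp add: d_def algebra_simps)
  then show thesis by (rule that)
qed

text \<open>The factors \<open>p\<close> are moved over one at a time: \<open>p\<close> is prime and
  does not divide \<open>q\<close>, so it divides the remaining cofactor of
  \<open>g\<close>.\<close>

lemma prime_power_dvd_mult_cancel:
  fixes p q g :: "'a::field poly"
  assumes "irreducible p" "\<not> p dvd q" "p ^ j dvd q * g"
  shows "p ^ j dvd g"
  using assms(3)
proof (induction j)
  case (Suc j)
  have p0: "p \<noteq> 0" using assms(1) by auto
  have "p ^ j dvd q * g" using Suc.prems by (meson dvd_trans le_imp_power_dvd le_SucI order_refl)
  from Suc.IH[OF this] obtain h where h: "g = p ^ j * h" by (elim dvdE)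
  then have "p ^ j * p dvd p ^ j * (q * h)" using Suc.prems by (simp add: mult_ac)
  then have "p dvd q * h" using p0 by (subst (asm) dvd_mult_cancel_left) simp
  then have "p dvd h"
    using field_poly_irreducible_imp_prime[OF assms(1)] assms(2) by (simp add: prime_elem_dvd_mult_iff)
  then show ?case using h by (simp add: mult_dvd_mono mult.commute)
qed simp

section \<open>Counting monic polynomials and multiples of a fixed one\<close>

lemma
  shows finite_monics: "finite (monics n :: 'a::{finite,field} poly set)"
    and card_monics: "card (monics n :: 'a::{finite,field} poly set) = CARD('a) ^ n"
proof -
  \<comment> \<open>A monic polynomial of degree \<open>n\<close> is coded by its \<open>n\<close>
    lower coefficients; the appended 1 is the leading one.\<close>
  have "bij_betw (\<lambda>xs. Poly (xs @ [1])) {xs :: 'a list. set xs \<subseteq> UNIV \<and> length xs = n} (monics n)"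
  proof (rule bij_betw_byWitness[where f' = "\<lambda>p. map (coeff p) [0..<n]"])
    show "\<forall>xs\<in>{xs::'a list. set xs \<subseteq> UNIV \<and> length xs = n}. map (coeff (Poly (xs @ [1]))) [0..<n] = xs"
      by (auto intro!: nth_equalityI simp: nth_default_append nth_default_nth)
    show "\<forall>p\<in>monics n. Poly (map (coeff p) [0..<n] @ [1]) = p"
      by (auto intro!: poly_eqI simp: monics_def nth_default_def nth_append le_less coeff_eq_0 less_Suc_eq)
    have "Poly (xs @ [1]) \<in> monics (length xs)" for xs :: "'a list"
    proof -
      define r where "r = Poly (xs @ [1])"
      have c: "coeff r i = (if i < length xs then xs ! i else if i = length xs then 1 else 0)" for i
        by (auto simp: r_def nth_default_def nth_append)
      have "degree r = length xs"
        by (rule antisym) (auto intro!: degree_le le_degree simp: c)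
      then show ?thesis by (simp add: monics_def c flip: r_def)
    qed
    then show "(\<lambda>xs. Poly (xs @ [1])) ` {xs::'a list. set xs \<subseteq> UNIV \<and> length xs = n} \<subseteq> monics n"
      by auto
  qed auto
  from bij_betw_same_card[OF this] bij_betw_finite[OF this]
  show "finite (monics n :: 'a poly set)" "card (monics n :: 'a poly set) = CARD('a) ^ n"
    using card_lists_length_eq[of "UNIV :: 'a set" n] finite_lists_length_eq[of "UNIV :: 'a set" n] by auto
qed

lemma card_monic_multiples:
  fixes p :: "'a::{finite,field} poly"
  assumes "p \<in> monics d"
  shows "card {f \<in> monics n. p dvd f} = (if d \<le> n then CARD('a) ^ (n - d) else 0)"
proof (cases "d \<le> n")
  case True
  have "p \<noteq> 0" using assms by (auto simp: monics_def)
  have "{f \<in> monics n. p dvd f} = (*) p ` monics (n - d)"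
  proof safe
    fix f assume f: "f \<in> monics n" "p dvd f"
    then obtain h where h: "f = p * h" by (elim dvdE)
    with f have "h \<noteq> 0" by (auto simp: monics_def)
    then have "h \<in> monics (n - d)" using f assms \<open>p \<noteq> 0\<close>
      by (auto simp: monics_def h coeff_mult_degree_sum degree_mult_eq)
    then show "f \<in> (*) p ` monics (n - d)" using h by blast
  next
    fix h :: "'a poly" assume h: "h \<in> monics (n - d)"
    have "h \<noteq> 0" using h by (auto simp: monics_def)
    have "lead_coeff p = 1" "lead_coeff h = 1" using h assms by (auto simp: monics_def)
    then have "lead_coeff (p * h) = 1" by (simp add: lead_coeff_mult)
    then show "p * h \<in> monics n" using h \<open>h \<noteq> 0\<close> assms True \<open>p \<noteq> 0\<close>
      by (auto simp: monics_def degree_mult_eq)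
  qed auto
  moreover have "inj_on ((*) p) (monics (n - d))" using \<open>p \<noteq> 0\<close> by (auto intro: inj_onI)
  ultimately show ?thesis using True by (simp add: card_image card_monics)
next
  case False
  have "f \<in> monics n \<Longrightarrow> p dvd f \<Longrightarrow> False" for f
    using dvd_imp_degree_le[of p f] assms False by (force simp: monics_def)
  then have "{f \<in> monics n. p dvd f} = {}" by blast
  then show ?thesis by (simp only: False if_False card.empty)
qed

section \<open>Counting monic irreducible polynomials\<close>

lemma finite_monic_irreds [simp]: "finite (monic_irreds n :: 'a::{finite,field} poly set)"
  unfolding monic_irreds_def by (rule finite_subset[OF _ finite_monics[of n]]) auto

lemma irreducible_power_dvd_self_mult:
  fixes p :: "'a::field poly"
  assumes "p \<noteq> 0" "j \<ge> 1"
  shows "p ^ j dvd p * g \<longleftrightarrow> p ^ (j - 1) dvd g"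
  using assms by (cases j) auto

text \<open>The inner cardinality is the multiplicity of \<open>p\<close> in \<open>f\<close>, so
  this is the degree of the factorization of \<open>f\<close>. The induction splits off one
  irreducible factor \<open>q\<close>, which raises the multiplicity of \<open>q\<close> by one and
  changes no other. The cut-off \<open>m\<close> is independent of the degree so that it stays fixed
  while the degree drops.\<close>

lemma degree_eq_sum_prime_powers:
  fixes f :: "'a::{finite,field} poly"
  assumes "lead_coeff f = 1" "degree f \<le> m"
  shows "degree f = (\<Sum>d=1..m. \<Sum>p\<in>monic_irreds d. d * card {j\<in>{1..m}. p ^ j dvd f})"
  using assms
proof (induction "degree f" arbitrary: f rule: less_induct)
  case less
  define c where "c = (\<lambda>f p :: 'a poly. card {j\<in>{1..m}. p ^ j dvd f})"
  show ?case
  proof (cases "degree f = 0")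
    case True
    then have f1: "f = 1" using less.prems(1) by (auto elim!: degree_eq_zeroE)
    have "card {j\<in>{1..m}. p ^ j dvd f} = 0" if "p \<in> monic_irreds d" for p :: "'a poly" and d
      using that by (auto simp: f1 monic_irreds_def is_unit_power_iff dest: irreducible_not_unit)
    then show ?thesis using True by simp
  next
    case False
    then obtain q where q: "irreducible q" "lead_coeff q = 1" "q dvd f"
      using monic_irreducible_divisor_exists by blast
    then obtain g where g: "f = q * g" by (elim dvdE)
    have "f \<noteq> 0" using less.prems by auto
    with g have nz: "q \<noteq> 0" "g \<noteq> 0" by auto
    have deg: "degree f = degree q + degree g" using g nz by (simp add: degree_mult_eq)
    have dq: "degree q > 0" using q(1) by (rule irreducible_degree_pos)
    have lg: "lead_coeff g = 1" using less.prems(1) q(2) by (simp add: g lead_coeff_mult)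
    have qm: "degree q \<in> {1..m}" "q \<in> monic_irreds (degree q)"
      using dq deg less.prems(2) q by (auto simp: monic_irreds_def monics_def)
    have other: "c f p = c g p" if "p \<in> monic_irreds d" "p \<noteq> q" for p d
    proof -
      have "\<not> p dvd q" using that q irreducible_monic_dvd_eq[of p q]
        by (auto simp: monic_irreds_def monics_def)
      then have "p ^ j dvd f \<longleftrightarrow> p ^ j dvd g" for j
        using prime_power_dvd_mult_cancel[of p q j g] that g by (auto simp: monic_irreds_def)
      then show ?thesis by (simp add: c_def)
    qed
    have self: "c f q = Suc (c g q)"
    proof -
      \<comment> \<open>Dividing by \<open>q\<close> shifts the exponents from \<open>{1..m}\<close>
        to \<open>{0..<m}\<close>. Exponent 0 always counts, and exponent \<open>m\<close> never
        counts for \<open>g\<close>, whose degree is below \<open>m\<close>; so \<open>f\<close> has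
        exactly one exponent more than \<open>g\<close>.\<close>
      have "\<not> q ^ m dvd g"
      proof
        assume "q ^ m dvd g"
        then have "degree (q ^ m) \<le> degree g" using nz by (intro dvd_imp_degree_le)
        moreover have "degree (q ^ m) = m * degree q" using nz by (simp add: degree_power_eq)
        moreover have "m \<le> m * degree q" using dq by simp
        ultimately show False using deg dq less.prems(2) by linarith
      qed
      moreover have "{j\<in>{1..m}. q ^ j dvd f} = Suc ` {j\<in>{0..<m}. q ^ j dvd g}"
      proof (intro set_eqI iffI)
        fix j assume "j \<in> {j\<in>{1..m}. q ^ j dvd f}"
        then have "j = Suc (j - 1)" "j - 1 \<in> {j\<in>{0..<m}. q ^ j dvd g}"
          using nz by (auto simp: g irreducible_power_dvd_self_mult)
        then show "j \<in> Suc ` {j\<in>{0..<m}. q ^ j dvd g}" by (rule image_eqI)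
      qed (use nz in \<open>auto simp: g\<close>)
      moreover have "{j\<in>{0..<m}. q ^ j dvd g} = insert 0 {j\<in>{1..m}. q ^ j dvd g}" if "\<not> q ^ m dvd g"
        using that qm by (auto simp: le_less Suc_le_eq)
      ultimately have "c f q = card (insert 0 {j\<in>{1..m}. q ^ j dvd g})"
        by (simp only: c_def card_image inj_Suc inj_on_subset[OF _ subset_UNIV] not_False_eq_True)
      then show ?thesis by (simp add: c_def)
    qed
    have IH: "degree g = (\<Sum>d=1..m. \<Sum>p\<in>monic_irreds d. d * c g p)"
      using less.hyps[of g] deg dq lg less.prems(2) by (simp add: c_def)
    have c_fold: "card {j\<in>{1..m}. p ^ j dvd f} = c f p" for p by (simp add: c_def)
    have inner: "(\<Sum>p\<in>monic_irreds d. d * c f p)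
        = (\<Sum>p\<in>monic_irreds d. d * c g p) + (if d = degree q then d else 0)" for d
    proof -
      have "(\<Sum>p\<in>monic_irreds d. d * c f p)
          = (\<Sum>p\<in>monic_irreds d. d * c g p + (if p = q then d else 0))"
        by (rule sum.cong) (auto simp: other self)
      also have "\<dots> = (\<Sum>p\<in>monic_irreds d. d * c g p) + (if q \<in> monic_irreds d then d else 0)"
        by (simp add: sum.distrib)
      also have "q \<in> monic_irreds d \<longleftrightarrow> d = degree q"
        using qm by (auto simp: monic_irreds_def monics_def)
      finally show ?thesis .
    qed
    show ?thesis using qm(1) unfolding c_fold
      by (simp only: inner sum.distrib flip: IH) (simp add: deg)
  qed
qed

lemma factors_le:
  fixes d j m :: nat
  assumes "d * j \<le> m" "Suc 0 \<le> d" "Suc 0 \<le> j"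
  shows "d \<le> m \<and> j \<le> m"
proof -
  have "d * 1 \<le> d * j" "1 * j \<le> d * j" using assms by (intro mult_le_mono; simp)+
  then show ?thesis using assms by linarith
qed

text \<open>Double counting: each monic irreducible \<open>p\<close> of degree \<open>d\<close> and
  each exponent \<open>j\<close> contribute \<open>d\<close> for every monic multiple of
  \<open>p ^ j\<close> of degree \<open>m\<close>, and there are
  \<open>CARD('a) ^ (m - d * j)\<close> of these.\<close>

lemma sum_degrees_monics:
  fixes m :: nat
  defines "M \<equiv> \<lambda>d. card (monic_irreds d :: 'a::{finite,field} poly set)"
  shows "m * CARD('a) ^ m =
    (\<Sum>(d, j)\<in>{(d, j). 1 \<le> d \<and> 1 \<le> j \<and> d * j \<le> m}. d * M d * CARD('a) ^ (m - d * j))"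
proof -
  let ?S = "monics m :: 'a poly set" and ?I = "monic_irreds :: nat \<Rightarrow> 'a poly set"
  have "m * CARD('a) ^ m = (\<Sum>f\<in>?S. degree f)"
    by (simp add: monics_def flip: card_monics)
  also have "\<dots> = (\<Sum>f\<in>?S. \<Sum>d=1..m. \<Sum>p\<in>?I d. d * card {j\<in>{1..m}. p ^ j dvd f})"
    by (intro sum.cong degree_eq_sum_prime_powers) (auto simp: monics_def)
  also have "\<dots> = (\<Sum>d=1..m. \<Sum>p\<in>?I d. \<Sum>f\<in>?S. d * card {j\<in>{1..m}. p ^ j dvd f})"
    by (subst sum.swap) (intro sum.cong refl sum.swap)
  also have "\<dots> = (\<Sum>d=1..m. \<Sum>p\<in>?I d. \<Sum>j=1..m. d * (if d * j \<le> m then CARD('a) ^ (m - d * j) else 0))"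
  proof (intro sum.cong refl)
    fix d and p :: "'a poly" assume p: "p \<in> ?I d"
    have "(\<Sum>f\<in>?S. card {j\<in>{1..m}. p ^ j dvd f}) = (\<Sum>f\<in>?S. \<Sum>j=1..m. if p ^ j dvd f then 1 else 0)"
      by (intro sum.cong refl) (simp add: sum.If_cases Int_def)
    also have "\<dots> = (\<Sum>j=1..m. card {f\<in>?S. p ^ j dvd f})"
      by (subst sum.swap) (simp add: sum.If_cases Int_def finite_monics)
    also have "\<dots> = (\<Sum>j=1..m. if d * j \<le> m then CARD('a) ^ (m - d * j) else 0)"
    proof (intro sum.cong refl)
      fix j
      have "p \<noteq> 0" using p by (auto simp: monic_irreds_def)
      moreover have "lead_coeff (p ^ j) = 1"
        using p unfolding monic_irreds_def monics_def by (subst lead_coeff_power) auto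
      ultimately have "p ^ j \<in> monics (d * j)"
        using p by (auto simp: monic_irreds_def monics_def degree_power_eq mult.commute)
      then show "card {f\<in>?S. p ^ j dvd f} = (if d * j \<le> m then CARD('a) ^ (m - d * j) else 0)"
        by (rule card_monic_multiples)
    qed
    finally show "(\<Sum>f\<in>?S. d * card {j\<in>{1..m}. p ^ j dvd f}) =
        (\<Sum>j=1..m. d * (if d * j \<le> m then CARD('a) ^ (m - d * j) else 0))"
      by (simp add: sum_distrib_left[symmetric])
  qed
  also have "\<dots> = (\<Sum>d=1..m. \<Sum>j=1..m. if d * j \<le> m then d * M d * CARD('a) ^ (m - d * j) else 0)"
    by (intro sum.cong refl) (simp add: M_def sum_distrib_left if_distrib mult_ac cong: if_cong)
  also have "\<dots> = (\<Sum>z\<in>{z\<in>{1..m}\<times>{1..m}. fst z * snd z \<le> m}.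
      fst z * M (fst z) * CARD('a) ^ (m - fst z * snd z))"
    by (subst sum.inter_filter) (simp_all add: sum.cartesian_product case_prod_unfold)
  also have "\<dots> = (\<Sum>(d, j)\<in>{(d, j). 1 \<le> d \<and> 1 \<le> j \<and> d * j \<le> m}. d * M d * CARD('a) ^ (m - d * j))"
  proof (rule sum.cong)
    show "{z\<in>{1..m}\<times>{1..m}. fst z * snd z \<le> m} = {(d, j). 1 \<le> d \<and> 1 \<le> j \<and> d * j \<le> m}"
      by (auto dest: factors_le)
  qed auto
  finally show ?thesis .
qed

text \<open>With q the field size, the pairs with \<open>d * j < m\<close> contribute q times the
  identity of \<open>sum_degrees_monics\<close> for \<open>m - 1\<close>, that is
  \<open>(m - 1) * q ^ m\<close>. The pairs with \<open>d * j = m\<close> account for the remaining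
  \<open>q ^ m\<close>, and they correspond to the divisors of \<open>m\<close>.\<close>

theorem sum_divisors_card_monic_irreds:
  assumes "m \<ge> 1"
  shows "(\<Sum>d | d dvd m. d * card (monic_irreds d :: 'a::{finite,field} poly set)) = CARD('a) ^ m"
proof -
  let ?M = "\<lambda>d. card (monic_irreds d :: 'a::{finite,field} poly set)"
  let ?P = "\<lambda>m. {(d, j). 1 \<le> d \<and> 1 \<le> j \<and> d * j \<le> m}"
  let ?E = "{(d, j). 1 \<le> d \<and> 1 \<le> j \<and> d * j = m}"
  obtain k where k: "m = Suc k" using assms by (cases m) auto
  have fin: "finite (?P m)"
  proof (rule finite_subset)
    show "?P m \<subseteq> {..m} \<times> {..m}"
      by (auto dest: factors_le)

  qed simp
  have split: "?P m = ?P k \<union> ?E" "?P k \<inter> ?E = {}" by (auto simp: k)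
  have "finite (?P k \<union> ?E)" using fin by (simp only: split(1))
  then have fin': "finite (?P k)" "finite ?E" by (simp_all only: finite_Un)
  have "m * CARD('a) ^ m = (\<Sum>(d, j)\<in>?P k. d * ?M d * CARD('a) ^ (m - d * j))
      + (\<Sum>(d, j)\<in>?E. d * ?M d * CARD('a) ^ (m - d * j))"
    using sum_degrees_monics[where 'a='a, of m]
    by (simp only: split(1) sum.union_disjoint[OF fin' split(2)])
  also have "(\<Sum>(d, j)\<in>?P k. d * ?M d * CARD('a) ^ (m - d * j))
      = CARD('a) * (\<Sum>(d, j)\<in>?P k. d * ?M d * CARD('a) ^ (k - d * j))"
    unfolding sum_distrib_left by (rule sum.cong) (auto simp: k Suc_diff_le)
  also have "\<dots> = CARD('a) * (k * CARD('a) ^ k)"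
    using sum_degrees_monics[where 'a='a, of k] by simp
  also have "(\<Sum>(d, j)\<in>?E. d * ?M d * CARD('a) ^ (m - d * j)) = (\<Sum>(d, j)\<in>?E. d * ?M d)"
    by (rule sum.cong) auto
  also have "\<dots> = (\<Sum>d | d dvd m. d * ?M d)"
    by (rule sum.reindex_bij_witness[of _ "\<lambda>d. (d, m div d)" fst])
      (use assms in \<open>auto simp: Suc_le_eq dvd_pos_nat intro!: Nat.gr0I\<close>)
  finally show ?thesis by (simp add: k algebra_simps)
qed


section \<open>The number of irreducible polynomials grows with the degree\<close>

lemma finite_irred_polys [simp]: "finite (irred_polys n :: 'a::{finite,field} poly set)"
  by (rule finite_subset[OF _ finite_monic_irreds[of n]])
    (auto simp: irred_polys_def monic_irreds_def monics_def)

text \<open>The only monic irreducible polynomial with zero constant term is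
  \<open>X\<close>.\<close>

lemma card_irred_polys:
  assumes "k \<ge> 1"
  shows "card (irred_polys k :: 'a::{finite,field} poly set)
    = card (monic_irreds k :: 'a poly set) - (if k = 1 then 1 else 0)"
proof -
  let ?X = "[:0, 1:] :: 'a poly"
  have X: "irreducible ?X" by (rule irreducible_linear_field_poly) simp
  have "coeff p 0 = 0 \<longleftrightarrow> p = ?X" if "p \<in> monic_irreds k" for p :: "'a poly"
  proof
    assume "coeff p 0 = 0"
    then have "?X dvd p" using poly_eq_0_iff_dvd[of p 0] by (simp add: poly_0_coeff_0)
    then show "p = ?X" using irreducible_monic_dvd_eq[OF X, of p] that
      by (auto simp: monic_irreds_def monics_def)
  qed auto
  then have eq: "irred_polys k = (monic_irreds k - {?X} :: 'a poly set)"
    by (auto simp: irred_polys_def monic_irreds_def monics_def)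
  have "?X \<in> monic_irreds k \<longleftrightarrow> k = 1" using X by (auto simp: monic_irreds_def monics_def)
  then show ?thesis by (simp add: eq card_Diff_singleton_if)
qed

lemma card_field_ge_2: "CARD('a::{finite,field}) \<ge> 2"
proof -
  have "card {0, 1 :: 'a} \<le> CARD('a)" by (rule card_mono) auto
  then show ?thesis by simp
qed

lemma card_monic_irreds_1: "card (monic_irreds 1 :: 'a::{finite,field} poly set) = CARD('a)"
  using sum_divisors_card_monic_irreds[of 1, where 'a='a] by simp

lemma sum_powers_bound:
  fixes q :: nat
  assumes "q \<ge> 2"
  shows "(\<Sum>d=1..t. q ^ d) + q \<le> q ^ Suc t"
proof (induction t)
  case (Suc t)
  have "(\<Sum>d=1..Suc t. q ^ d) + q \<le> 2 * q ^ Suc t" using Suc by simp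
  also have "\<dots> \<le> q * q ^ Suc t" using assms by (intro mult_right_mono) auto
  finally show ?case by simp
qed simp

lemma degree_times_card_monic_irreds_le:
  assumes "d \<ge> 1"
  shows "d * card (monic_irreds d :: 'a::{finite,field} poly set) \<le> CARD('a) ^ d"
proof -
  have fin: "finite {e. e dvd d}" using assms by simp
  show ?thesis
    using member_le_sum[OF _ _ fin, of d "\<lambda>d. d * card (monic_irreds d :: 'a poly set)"]
    by (simp add: sum_divisors_card_monic_irreds[OF assms])
qed

text \<open>Only the divisors 1 and \<open>k\<close> are kept in the divisor sum; the divisor 1
  contributes exactly \<open>CARD('a)\<close>.\<close>

lemma card_monic_irreds_upper:
  assumes "k \<ge> 2"
  shows "k * card (monic_irreds k :: 'a::{finite,field} poly set) + CARD('a) \<le> CARD('a) ^ k"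
proof -
  let ?f = "\<lambda>d. d * card (monic_irreds d :: 'a poly set)"
  have "sum ?f {1, k} \<le> sum ?f {d. d dvd k}" using assms by (intro sum_mono2) auto
  also have "\<dots> = CARD('a) ^ k" using assms by (intro sum_divisors_card_monic_irreds) simp
  finally show ?thesis using assms by (simp add: card_monic_irreds_1[unfolded One_nat_def])
qed

text \<open>Proper divisors of \<open>m\<close> are at most \<open>m div 2\<close>, and each of them
  contributes at most \<open>CARD('a) ^ d\<close> to the divisor sum, so together they stay below a
  geometric sum.\<close>

lemma card_monic_irreds_lower:
  assumes "m \<ge> 1"
  shows "CARD('a) ^ m + CARD('a)
    \<le> m * card (monic_irreds m :: 'a::{finite,field} poly set) + CARD('a) ^ Suc (m div 2)"
proof -
  let ?f = "\<lambda>d. d * card (monic_irreds d :: 'a poly set)"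
  have "{d. d dvd m} = insert m {d. d dvd m \<and> d \<noteq> m}" by auto
  moreover have "finite {d. d dvd m \<and> d \<noteq> m}" using assms by simp
  ultimately have "CARD('a) ^ m = ?f m + sum ?f {d. d dvd m \<and> d \<noteq> m}"
    using sum_divisors_card_monic_irreds[OF assms, where 'a='a] by simp
  also have "sum ?f {d. d dvd m \<and> d \<noteq> m} \<le> sum ?f {1..m div 2}"
  proof (rule sum_mono2)
    show "{d. d dvd m \<and> d \<noteq> m} \<subseteq> {1..m div 2}"
    proof safe
      fix d assume "d dvd m" "d \<noteq> m"
      then obtain c where c: "m = d * c" by (elim dvdE)
      then have "c \<noteq> 0" "c \<noteq> 1" using assms \<open>d \<noteq> m\<close> by auto
      then have "d * 2 \<le> d * c" by (intro mult_le_mono2) simp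
      then have "d * 2 \<le> m" by (simp only: c)
      moreover have "d \<noteq> 0" using c assms by (intro notI) simp
      ultimately show "d \<in> {1..m div 2}" by auto
    qed
  qed auto
  also have "\<dots> \<le> (\<Sum>d=1..m div 2. CARD('a) ^ d)"
    by (intro sum_mono degree_times_card_monic_irreds_le) auto
  finally show ?thesis using sum_powers_bound[OF card_field_ge_2[where 'a='a], of "m div 2"] by linarith
qed

text \<open>This is what remains to be checked after the upper bound for degree \<open>k\<close> is
  multiplied by \<open>Suc k\<close> and the lower bound for degree \<open>Suc k\<close> by
  \<open>k\<close>.\<close>

lemma power_comparison:
  fixes q k :: nat
  assumes "q \<ge> 2" "k \<ge> 2"
  shows "Suc k * q ^ k + k * q ^ Suc (Suc k div 2) \<le> k * q ^ Suc k + k * q + Suc k * q"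
proof -
  define Q T where "Q = q ^ k" and "T = q ^ Suc (Suc k div 2)"
  have TQ: "T \<le> Q" unfolding Q_def T_def using assms by (intro power_increasing) auto
  have "Suc k * Q + k * T \<le> k * (q * Q) + k * q + Suc k * q"
  proof (cases "q \<ge> 3")
    case True
    have "Suc k * Q + k * T \<le> Suc k * Q + k * Q" using TQ by simp
    also have "\<dots> \<le> (3 * k) * Q" using assms by (simp flip: add_mult_distrib)
    also have "\<dots> = k * (3 * Q)" by simp
    also have "\<dots> \<le> k * (q * Q)" using True by simp
    finally show ?thesis by simp
  next
    case False
    \<comment> \<open>For \<open>q = 2\<close> the estimate \<open>T \<le> Q\<close> is too weak.
      From \<open>k = 4\<close> on, \<open>2 * T \<le> Q\<close> repairs this; for
      \<open>k = 2\<close> and \<open>k = 3\<close> the terms linear in \<open>q\<close> are what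
      makes the inequality true.\<close>
    then have q: "q = 2" using assms by simp
    consider "k = 2" | "k = 3" | "k \<ge> 4" using assms by linarith
    then show ?thesis
    proof cases
      case 3
      have "2 * T \<le> Q"
        using power_increasing[of "Suc (Suc (Suc k div 2))" k q] 3 q by (simp add: Q_def T_def)
      then have "k * (2 * T) \<le> k * Q" by (rule mult_le_mono2)
      moreover have "2 * Q \<le> k * Q" using 3 by simp
      ultimately have "Suc k * Q + k * T \<le> k * (2 * Q)" unfolding mult_Suc by linarith
      then show ?thesis by (simp add: q)
    qed (simp_all add: Q_def T_def q)
  qed
  then show ?thesis by (simp add: Q_def T_def)
qed

lemma card_irred_polys_Suc:
  assumes "k \<ge> 1"
  shows "card (irred_polys k :: 'a::{finite,field} poly set) \<le> card (irred_polys (Suc k) :: 'a poly set)"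
proof -
  let ?M = "\<lambda>d. card (monic_irreds d :: 'a poly set)" and ?q = "CARD('a)"
  have q: "?q \<ge> 2" by (rule card_field_ge_2)
  show ?thesis
  proof (cases "k = 1")
    \<comment> \<open>Degree 1 is the only one where \<open>X\<close> is left out. Over the field
      with two elements this is decisive: there are two monic irreducibles of degree 1 but only one
      of degree 2.\<close>
    case True
    have "d = 1 \<or> d = 2" if "d dvd 2" for d :: nat
      using dvd_imp_le[OF that] that by (cases "d = 0") auto
    then have "{d. d dvd 2} = {1, 2::nat}" by auto
    then have "?q + 2 * ?M 2 = ?q ^ 2"
      using sum_divisors_card_monic_irreds[of 2, where 'a='a] card_monic_irreds_1[where 'a='a] by simp
    moreover obtain r where "?q = r + 2" using q le_Suc_ex add.commute by metis
    ultimately have "?q - 1 \<le> ?M 2" by (simp add: power2_eq_square algebra_simps)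
    then show ?thesis
      using True card_monic_irreds_1[where 'a='a] by (simp add: card_irred_polys numeral_2_eq_2)
  next
    case False
    then have k: "k \<ge> 2" using assms by simp
    have "Suc k * k * ?M k + Suc k * ?q \<le> Suc k * ?q ^ k"
      using mult_le_mono2[OF card_monic_irreds_upper[OF k, where 'a='a], of "Suc k"]
      by (simp add: algebra_simps)
    moreover have "k * ?q ^ Suc k + k * ?q \<le> Suc k * k * ?M (Suc k) + k * ?q ^ Suc (Suc k div 2)"
      using mult_le_mono2[OF card_monic_irreds_lower[of "Suc k", where 'a='a], of k]
      by (simp add: algebra_simps)
    moreover note power_comparison[OF q k]
    ultimately have "Suc k * k * ?M k \<le> Suc k * k * ?M (Suc k)" by linarith
    then have "?M k \<le> ?M (Suc k)" using k by simp
    then show ?thesis using k by (simp add: card_irred_polys)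
  qed
qed

lemma card_irred_polys_mono:
  assumes "1 \<le> k" "k \<le> m"
  shows "card (irred_polys k :: 'a::{finite,field} poly set) \<le> card (irred_polys m :: 'a poly set)"
  using assms(2)
proof (induction m rule: dec_induct)
  case (step m)
  then show ?case using card_irred_polys_Suc[of m, where 'a='a] assms(1) by linarith
qed simp

section \<open>Pairwise coprime families\<close>

lemma irred_polysD:
  assumes "g \<in> irred_polys k"
  shows "irreducible g" "lead_coeff g = 1" "degree g = k" "coeff g 0 \<noteq> 0" "k \<ge> 1" "g \<noteq> 0"
  using assms irreducible_degree_pos[of g] by (auto simp: irred_polys_def)

lemma monic_polysD:
  assumes "f \<in> monic_polys n"
  shows "lead_coeff f = 1" "degree f = n" "coeff f 0 \<noteq> 0" "f \<noteq> 0"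
  using assms by (auto simp: monic_polys_def)

lemma irred_polys_subset_monic: "irred_polys k \<subseteq> monic_polys k"
  by (auto simp: irred_polys_def monic_polys_def)

lemma irreducible_dvd_monic_poly:
  assumes "irreducible g" "lead_coeff g = 1" "g dvd f" "f \<in> monic_polys n"
  shows "g \<in> irred_polys (degree g)"
  using assms by (auto simp: irred_polys_def monic_polys_def coeff_mult_0 elim!: dvdE)

lemma monic_dvd_same_degree_eq:
  fixes p q :: "'a::field poly"
  assumes "p \<in> monic_polys n" "q \<in> monic_polys n" "p dvd q"
  shows "p = q"
proof -
  obtain c where c: "q = p * c" using assms(3) by (elim dvdE)
  have nz: "p \<noteq> 0" "q \<noteq> 0" using assms monic_polysD(4) by blast+
  then have "c \<noteq> 0" using c by auto
  then have "degree c = 0" using c nz assms by (auto simp: monic_polys_def degree_mult_eq)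
  moreover have "lead_coeff c = 1"
    using monic_polysD(1)[OF assms(1)] monic_polysD(1)[OF assms(2)] by (simp add: c lead_coeff_mult)
  ultimately have "c = 1" by (auto elim!: degree_eq_zeroE)
  with c show ?thesis by simp
qed

lemma irreducible_dvd_power_mult:
  fixes p g h :: "'a::field poly"
  assumes "irreducible p" "lead_coeff p = 1" "g \<in> irred_polys k" "p dvd g ^ b * h"
  shows "p = g \<or> p dvd h"
proof -
  have "prime_elem p" using assms(1) by (rule field_poly_irreducible_imp_prime)
  then have "p dvd g \<or> p dvd h"
    using assms(4) by (auto simp: prime_elem_dvd_mult_iff dest: prime_elem_dvd_power)
  then show ?thesis
    using irreducible_monic_dvd_eq[of p g] irred_polysD[OF assms(3)] assms(1,2) by auto
qed

text \<open>Take an irreducible factor \<open>g\<close> with cofactor \<open>h\<close> of positive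
  degree. If \<open>g\<close> has degree above \<open>n/2\<close>, then \<open>h\<close>, and any
  irreducible factor of it, has degree below \<open>n/2\<close>.\<close>

lemma reducible_small_divisor:
  fixes f :: "'a::field poly"
  assumes "f \<in> monic_polys n" "n \<ge> 1" "\<not> irreducible f"
  obtains g k where "g \<in> irred_polys k" "2 * k \<le> n" "g dvd f"
proof -
  note f = monic_polysD[OF assms(1)]
  have "\<exists>g. irreducible g \<and> lead_coeff g = 1 \<and> g dvd f \<and> 2 * degree g \<le> n"
  proof -
    obtain g where g: "irreducible g" "lead_coeff g = 1" "g dvd f"
      using monic_irreducible_divisor_exists[of f] f(2) assms(2) by auto
    then obtain h where h: "f = g * h" by (elim dvdE)
    have nz: "g \<noteq> 0" "h \<noteq> 0" using f(4) h by auto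
    then have deg: "n = degree g + degree h" using h f(2) by (simp add: degree_mult_eq)
    have "\<not> is_unit h" using h g(1) assms(3) irreducible_mult_unit_left[of h g] by (auto simp: mult.commute)
    then have dh: "degree h > 0" using nz is_unit_iff_degree by blast
    show ?thesis
    proof (cases "2 * degree g \<le> n")
      case False
      obtain p where p: "irreducible p" "lead_coeff p = 1" "p dvd h"
        using monic_irreducible_divisor_exists[OF dh] by auto
      then have "degree p \<le> degree h" using nz by (simp add: dvd_imp_degree_le)
      with False deg have "2 * degree p \<le> n" by linarith
      with p h show ?thesis by auto
    qed (use g in auto)
  qed
  then show thesis using that irreducible_dvd_monic_poly[OF _ _ _ assms(1)] by blast
qed

section \<open>Key irreducible factors and the upper bound\<close>

definition key_irreds :: "nat \<Rightarrow> 'a::field poly set" where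
  "key_irreds n = irred_polys n \<union> (\<Union>k\<in>{1..n div 2}. irred_polys k)"

lemma key_irreds_iff:
  "g \<in> key_irreds n \<longleftrightarrow> g \<in> irred_polys n \<or> (\<exists>k. 2 * k \<le> n \<and> g \<in> irred_polys k)"
proof -
  have "k \<in> {1..n div 2} \<longleftrightarrow> 2 * k \<le> n" if "g \<in> irred_polys k" for k
    using irred_polysD(5)[OF that] by auto
  then show ?thesis unfolding key_irreds_def by blast
qed

lemma key_irreds_irred: "g \<in> key_irreds n \<Longrightarrow> g \<in> irred_polys (degree g)"
  by (auto simp: key_irreds_def irred_polys_def)

lemma card_key_irreds:
  assumes "n \<ge> 1"
  shows "card (key_irreds n :: 'a::{finite,field} poly set)
    = card (irred_polys n :: 'a poly set) + (\<Sum>k = 1..n div 2. card (irred_polys k :: 'a poly set))"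
proof -
  have disj: "irred_polys i \<inter> irred_polys j = ({} :: 'a poly set)" if "i \<noteq> j" for i j
    using that by (auto simp: irred_polys_def)
  then have "irred_polys n \<inter> (\<Union>k\<in>{1..n div 2}. irred_polys k) = ({} :: 'a poly set)"
  proof -
    have "k \<noteq> n" if "k \<in> {1..n div 2}" for k using that assms by auto
    then show ?thesis using disj by blast
  qed
  then show ?thesis
    unfolding key_irreds_def by (simp add: card_Un_disjoint card_UN_disjoint disj)
qed

lemma finite_key_irreds [simp]: "finite (key_irreds n :: 'a::{finite,field} poly set)"
  by (auto simp: key_irreds_def)

text \<open>Irreducibles of degree strictly between \<open>n/2\<close> and \<open>n\<close> stay
  outside \<open>key_irreds\<close>: a polynomial with such a factor is reducible and so has an
  irreducible factor of degree at most \<open>n/2\<close> as well.\<close>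

lemma key_divisor_exists:
  assumes "f \<in> monic_polys n" "n \<ge> 1"
  shows "\<exists>g\<in>key_irreds n. g dvd f"
proof (cases "irreducible f")
  case True
  then have "f \<in> irred_polys n" using assms by (auto simp: irred_polys_def monic_polys_def)
  then show ?thesis by (intro bexI[of _ f]) (auto simp: key_irreds_iff)
next
  case False
  with assms show ?thesis
    by (meson reducible_small_divisor key_irreds_iff)
qed

lemma coprime_family_common_divisor:
  assumes "R \<in> coprime_families n" "f \<in> R" "f' \<in> R" "irreducible g" "g dvd f" "g dvd f'"
  shows "f = f'"
  using assms coprime_common_divisor irreducible_not_unit
  unfolding coprime_families_def pairwise_def by blast

lemma coprime_family_finite:
  "R \<in> coprime_families n \<Longrightarrow> finite (R :: 'a::{finite,field} poly set)"
  by (rule finite_subset[OF _ finite_monics[of n]])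
    (auto simp: coprime_families_def monic_polys_def monics_def)

text \<open>Any choice of key divisors is injective, since two members with the same key would share
  an irreducible divisor.\<close>

lemma coprime_family_choice:
  assumes "R \<in> coprime_families n" "n \<ge> 1"
  shows "\<exists>\<phi>. \<phi> ` R \<subseteq> key_irreds n \<and> inj_on \<phi> R \<and> (\<forall>f\<in>R. \<phi> f dvd f)"
proof -
  have "\<forall>f\<in>R. \<exists>g. g \<in> key_irreds n \<and> g dvd f"
    using assms key_divisor_exists unfolding coprime_families_def by blast
  then obtain \<phi> where \<phi>: "\<And>f. f \<in> R \<Longrightarrow> \<phi> f \<in> key_irreds n" "\<And>f. f \<in> R \<Longrightarrow> \<phi> f dvd f"
    by metis
  have "inj_on \<phi> R"
  proof (rule inj_onI)
    fix f f' assume f: "f \<in> R" "f' \<in> R" "\<phi> f = \<phi> f'"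
    then show "f = f'"
      using coprime_family_common_divisor[OF assms(1) f(1,2), of "\<phi> f"] \<phi>(2)[of f] \<phi>(2)[of f']
        irred_polysD(1)[OF key_irreds_irred[OF \<phi>(1)[of f]]] by simp
  qed
  with \<phi> show ?thesis by (intro exI[of _ \<phi>]) auto
qed

lemma card_coprime_family_le:
  fixes R :: "'a::{finite,field} poly set"
  assumes "R \<in> coprime_families n" "n \<ge> 1"
  shows "card R \<le> card (key_irreds n :: 'a poly set)"
proof -
  obtain \<phi> where "\<phi> ` R \<subseteq> key_irreds n \<and> inj_on \<phi> R \<and> (\<forall>f\<in>R. \<phi> f dvd f)"
    using coprime_family_choice[OF assms] ..
  then show ?thesis by (intro card_inj_on_le[of \<phi>]) simp_all
qed

text \<open>A family of full size makes every choice of key divisors bijective, so no member has two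
  key divisors.\<close>

lemma full_coprime_family:
  fixes R :: "'a::{finite,field} poly set"
  assumes "R \<in> coprime_families n" "n \<ge> 1" "card R = card (key_irreds n :: 'a poly set)"
  shows "\<And>g. g \<in> key_irreds n \<Longrightarrow> \<exists>f\<in>R. g dvd f"
    and "\<And>f g g'. f \<in> R \<Longrightarrow> g \<in> key_irreds n \<Longrightarrow> g' \<in> key_irreds n \<Longrightarrow> g dvd f \<Longrightarrow> g' dvd f \<Longrightarrow> g = g'"
proof -
  obtain \<phi> where "\<phi> ` R \<subseteq> key_irreds n \<and> inj_on \<phi> R \<and> (\<forall>f\<in>R. \<phi> f dvd f)"
    using coprime_family_choice[OF assms(1,2)] ..
  then have \<phi>: "\<phi> ` R \<subseteq> key_irreds n" "inj_on \<phi> R" "\<And>f. f \<in> R \<Longrightarrow> \<phi> f dvd f"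
    by simp_all
  have img: "\<phi> ` R = key_irreds n"
    using \<phi>(1,2) assms(3) by (intro card_subset_eq) (auto simp: card_image)
  show "\<exists>f\<in>R. g dvd f" if "g \<in> key_irreds n" for g
  proof -
    have "g \<in> \<phi> ` R" using that by (simp add: img)
    then obtain f where "f \<in> R" "g = \<phi> f" by blast
    then show ?thesis using \<phi>(3)[of f] by (intro bexI[of _ f]) simp_all
  qed
  \<comment> \<open>As \<open>\<phi>\<close> is onto, \<open>g\<close> is the key chosen for some
    \<open>f'\<close>. Then \<open>g\<close> divides both \<open>f\<close> and \<open>f'\<close>,
    and coprimality forces \<open>f = f'\<close>.\<close>
  have unique: "g = \<phi> f" if f: "f \<in> R" and g: "g \<in> key_irreds n" "g dvd f" for f g
  proof -
    have "g \<in> \<phi> ` R" using g(1) by (simp add: img)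
    then obtain f' where "f' \<in> R" "g = \<phi> f'" by blast
    then show ?thesis
      using coprime_family_common_divisor[OF assms(1) f, of f' g] \<phi>(3) f g
        irred_polysD(1)[OF key_irreds_irred[OF g(1)]] by auto
  qed
  show "g = g'" if "f \<in> R" "g \<in> key_irreds n" "g' \<in> key_irreds n" "g dvd f" "g' dvd f" for f g g'
    using unique[of f g] unique[of f g'] that by simp
qed

text \<open>Converse of \<open>full_coprime_family\<close>: picking for each key a member that it
  divides gives an injection from the keys into \<open>R\<close>, because no member has two
  keys.\<close>

lemma card_full_coprime_family:
  fixes R :: "'a::{finite,field} poly set"
  assumes "R \<in> coprime_families n" "n \<ge> 1"
    and ex: "\<And>g. g \<in> key_irreds n \<Longrightarrow> \<exists>f\<in>R. g dvd f"
    and unique: "\<And>f g g'. f \<in> R \<Longrightarrow> g \<in> key_irreds n \<Longrightarrow> g' \<in> key_irreds n \<Longrightarrow> g dvd f \<Longrightarrow> g' dvd f \<Longrightarrow> g = g'"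
  shows "card R = card (key_irreds n :: 'a poly set)"
proof (rule antisym[OF card_coprime_family_le[OF assms(1,2)]])
  obtain \<psi> where \<psi>: "\<And>g. g \<in> key_irreds n \<Longrightarrow> \<psi> g \<in> R \<and> g dvd \<psi> g" using ex by metis
  have "inj_on \<psi> (key_irreds n)" using \<psi> unique by (metis inj_onI)
  then show "card (key_irreds n :: 'a poly set) \<le> card R"
    using \<psi> coprime_family_finite[OF assms(1)] by (intro card_inj_on_le) auto
qed

section \<open>A coprime family attaining the bound\<close>

lemma monic_polys_mult: "f \<in> monic_polys m \<Longrightarrow> g \<in> monic_polys n \<Longrightarrow> f * g \<in> monic_polys (m + n)"
proof -
  assume f: "f \<in> monic_polys m" and g: "g \<in> monic_polys n"
  have "lead_coeff (f * g) = 1" using monic_polysD(1)[OF f] monic_polysD(1)[OF g] by (simp add: lead_coeff_mult)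
  moreover have "degree (f * g) = m + n"
    using monic_polysD(2,4)[OF f] monic_polysD(2,4)[OF g] by (simp add: degree_mult_eq)
  ultimately show ?thesis
    using monic_polysD(3)[OF f] monic_polysD(3)[OF g] by (simp add: monic_polys_def coeff_mult_0)
qed

lemma full_coprime_family_exists:
  assumes "n \<ge> 1"
  shows "\<exists>R :: 'a::{finite,field} poly set. R \<in> coprime_families n \<and> card R = card (key_irreds n :: 'a poly set)"
proof -
  \<comment> \<open>For \<open>2 * k < n\<close> the degrees satisfy \<open>k \<le> n - k\<close>,
    so monotonicity of the counts yields an injection. Degree 0 has no irreducibles and is included
    only to have one map for every \<open>k\<close>.\<close>
  have "\<exists>\<iota> :: 'a poly \<Rightarrow> 'a poly. 2 * k < n \<longrightarrow> \<iota> ` irred_polys k \<subseteq> irred_polys (n - k) \<and> inj_on \<iota> (irred_polys k)" for k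
  proof (cases "k = 0")
    case True
    then have "irred_polys k = ({} :: 'a poly set)" using irred_polysD(5) by fastforce
    then show ?thesis by (intro exI[of _ id]) simp
  next
    case False
    then show ?thesis
      using card_le_inj[OF finite_irred_polys finite_irred_polys card_irred_polys_mono[of k "n - k"]]
      by force
  qed
  then obtain \<iota> :: "nat \<Rightarrow> 'a poly \<Rightarrow> 'a poly" where \<iota>: "\<And>k. 2 * k < n \<Longrightarrow> \<iota> k ` irred_polys k \<subseteq> irred_polys (n - k)"
    "\<And>k. 2 * k < n \<Longrightarrow> inj_on (\<iota> k) (irred_polys k)" by metis
  \<comment> \<open>Every key is completed to degree \<open>n\<close>. The cofactor added in the
    last case has degree strictly between \<open>n/2\<close> and \<open>n\<close>, so it is never a
    key itself.\<close>
  define \<sigma> where "\<sigma> g = (if degree g = n then g else if 2 * degree g = n then g ^ 2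
    else g * \<iota> (degree g) g)" for g :: "'a poly"
  have key: "g \<in> irred_polys (degree g)" "degree g = n \<or> 2 * degree g \<le> n"
    if "g \<in> key_irreds n" for g :: "'a poly"
    using that by (auto simp: key_irreds_iff irred_polys_def)
  have mem: "\<sigma> g \<in> monic_polys n" if "g \<in> key_irreds n" for g
  proof -
    have m: "g \<in> monic_polys (degree g)" using key[OF that] irred_polys_subset_monic by blast
    have "\<iota> (degree g) g \<in> monic_polys (n - degree g)" if "2 * degree g < n"
      using \<iota>(1)[OF that] key(1)[OF \<open>g \<in> key_irreds n\<close>] irred_polys_subset_monic by blast
    then show ?thesis using key(2)[OF that] m monic_polys_mult[OF m]
      by (fastforce simp: \<sigma>_def power2_eq_square mult_2)
  qed
  have divisors: "p = g \<or> 2 * degree g < n \<and> p = \<iota> (degree g) g"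
    if "g \<in> key_irreds n" "irreducible p" "lead_coeff p = 1" "p dvd \<sigma> g" for p g
  proof -
    note gk = key[OF that(1)]
    consider "degree g = n" | "2 * degree g = n" "degree g \<noteq> n" | "2 * degree g < n" "degree g \<noteq> n"
      using gk by linarith
    then show ?thesis
    proof cases
      case 1
      then show ?thesis
        using that gk irreducible_dvd_power_mult[of p g _ 1 1] by (auto simp: \<sigma>_def irreducible_not_unit)
    next
      case 2
      then show ?thesis
        using that gk irreducible_dvd_power_mult[of p g _ 2 1] by (auto simp: \<sigma>_def irreducible_not_unit)
    next
      case 3
      then have i: "\<iota> (degree g) g \<in> irred_polys (n - degree g)" using \<iota>(1) gk by blast
      have "p dvd g * \<iota> (degree g) g" using that(4) 3 by (simp add: \<sigma>_def)
      then show ?thesis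
        using that(2,3) 3 irreducible_dvd_power_mult[OF that(2,3) gk(1), of 1 "\<iota> (degree g) g"]
          irreducible_monic_dvd_eq[of p "\<iota> (degree g) g"] irred_polysD(1,2)[OF i] by auto
    qed
  qed
  have cop: "coprime (\<sigma> g) (\<sigma> g')" if g: "g \<in> key_irreds n" "g' \<in> key_irreds n" "g \<noteq> g'" for g g'
  proof -
    \<comment> \<open>A common factor of two values is a key or an added cofactor on each side.
      Degrees exclude the mixed cases; if it is a cofactor on both sides, \<open>g\<close> and
      \<open>g'\<close> have the same degree and injectivity of \<open>\<iota>\<close> gives
      \<open>g = g'\<close>.\<close>
    have "False" if p: "irreducible p" "lead_coeff p = 1" "p dvd \<sigma> g" "p dvd \<sigma> g'" for p
    proof -
      have deg: "2 * degree p > n" "degree p = n - degree g" "degree p \<noteq> n"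
        if "2 * degree g < n" "p = \<iota> (degree g) g" "g \<in> key_irreds n" for g
      proof -
        have "p \<in> irred_polys (n - degree g)" using \<iota>(1)[OF that(1)] key(1)[OF that(3)] that(2) by blast
        from irred_polysD(3)[OF this] show "degree p = n - degree g" .
        then show "2 * degree p > n" "degree p \<noteq> n"
          using that(1) irred_polysD(5)[OF key(1)[OF that(3)]] by linarith+
      qed
      have "p = g \<or> 2 * degree g < n \<and> p = \<iota> (degree g) g"
        "p = g' \<or> 2 * degree g' < n \<and> p = \<iota> (degree g') g'"
        using divisors p g by blast+
      then show False
      proof (elim disjE conjE)
        assume a: "2 * degree g < n" "p = \<iota> (degree g) g" "2 * degree g' < n" "p = \<iota> (degree g') g'"
        then have "degree g = degree g'" using deg[of g] deg[of g'] g by linarith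
        then show False using a g \<iota>(2)[OF a(1)] key(1) by (metis inj_onD)
      next
        assume a: "p = g" "2 * degree g' < n" "p = \<iota> (degree g') g'"
        show False using deg[OF a(2,3) g(2)] key(2)[OF g(1)] unfolding a(1) by linarith
      next
        assume a: "p = g'" "2 * degree g < n" "p = \<iota> (degree g) g"
        show False using deg[OF a(2,3) g(1)] key(2)[OF g(2)] unfolding a(1) by linarith
      qed (use g in auto)
    qed
    then show ?thesis
      unfolding coprime_iff_no_common_irreducible[OF monic_polysD(4)[OF mem[OF g(1)]]] by blast
  qed
  have inj: "inj_on \<sigma> (key_irreds n)"
  proof (rule inj_onI, rule ccontr)
    fix g g' assume g: "g \<in> key_irreds n" "g' \<in> key_irreds n" "\<sigma> g = \<sigma> g'" "g \<noteq> g'"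
    then have "is_unit (\<sigma> g)" using cop[of g g'] by simp
    then show False
      using monic_polysD(2,4)[OF mem[OF g(1)]] assms is_unit_iff_degree[of "\<sigma> g"] by simp
  qed
  show ?thesis
  proof (intro exI conjI)
    show "\<sigma> ` key_irreds n \<in> coprime_families n"
      using mem cop by (auto simp: coprime_families_def pairwise_def)
    show "card (\<sigma> ` key_irreds n) = card (key_irreds n :: 'a poly set)" using inj by (rule card_image)
  qed
qed

lemma max_coprime_eq:
  assumes "n \<ge> 1"
  shows "max_coprime TYPE('a::{finite,field}) n = card (key_irreds n :: 'a poly set)"
  unfolding max_coprime_def
proof (rule Max_eqI)
  have "coprime_families n \<subseteq> Pow (monics n :: 'a poly set)"
    by (auto simp: coprime_families_def monic_polys_def monics_def)
  then show "finite (card ` (coprime_families n :: 'a poly set set))"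
    using finite_monics by (meson finite_Pow_iff finite_imageI finite_subset)
  show "card (key_irreds n :: 'a poly set) \<in> card ` (coprime_families n :: 'a poly set set)"
  proof -
    obtain R :: "'a poly set" where "R \<in> coprime_families n" "card R = card (key_irreds n :: 'a poly set)"
      using full_coprime_family_exists[OF assms] by blast
    then show ?thesis by (metis imageI)
  qed
  show "y \<le> card (key_irreds n :: 'a poly set)" if "y \<in> card ` (coprime_families n :: 'a poly set set)" for y
    using that card_coprime_family_le assms by blast
qed

section \<open>Structure of the maximal families\<close>

lemma irreducible_power_decomposition:
  fixes f g :: "'a::field poly"
  assumes "irreducible g" "f \<noteq> 0"
  obtains b h where "f = g ^ b * h" "\<not> g dvd h"
  using assms(2)
proof (induction "degree f" arbitrary: f thesis rule: less_induct)
  case less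
  show ?case
  proof (cases "g dvd f")
    case True
    then obtain c where c: "f = g * c" by (elim dvdE)
    with less.prems(2) have nz: "g \<noteq> 0" "c \<noteq> 0" by auto
    then have "degree c < degree f"
      using irreducible_degree_pos[OF assms(1)] by (simp add: c degree_mult_eq)
    then obtain b h where "c = g ^ b * h" "\<not> g dvd h" using less.hyps nz(2) by blast
    then have "f = g ^ Suc b * h" "\<not> g dvd h" by (simp_all add: c)
    then show ?thesis by (rule less.prems(1))
  next
    case False
    then show ?thesis using less.prems(1)[of 0 f] by simp
  qed
qed

text \<open>Split off the full power of \<open>g\<close>. The cofactor \<open>h\<close> has no
  irreducible factor of degree at most \<open>n/2\<close>, since that would be a second key; so
  \<open>h\<close> is 1 or irreducible of degree above \<open>n/2\<close>, and in the latter case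
  less than \<open>n/2\<close> is left for the power of \<open>g\<close>.\<close>

lemma single_key_divisor_form:
  fixes f g :: "'a::field poly"
  assumes "f \<in> monic_polys n" "g \<in> irred_polys k" "2 * k \<le> n" "g dvd f"
    and unique: "\<And>g'. g' \<in> key_irreds n \<Longrightarrow> g' dvd f \<Longrightarrow> g' = g"
  shows "k dvd n \<and> f = g ^ (n div k) \<or>
    (\<exists>b h. b \<ge> 1 \<and> 2 * (b * k) < n \<and> h \<in> irred_polys (n - b * k) \<and> f = g ^ b * h)"
proof -
  note f = monic_polysD[OF assms(1)] and g = irred_polysD[OF assms(2)]
  obtain b h where fh: "f = g ^ b * h" and ndvd: "\<not> g dvd h"
    using irreducible_power_decomposition[OF g(1) f(4)] by blast
  have b: "b \<ge> 1" using fh ndvd assms(4) by (cases b) auto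
  have h0: "h \<noteq> 0" using fh f(4) by auto
  have deg: "n = b * k + degree h"
    using f(2) g(3,6) h0 by (simp add: fh degree_mult_eq degree_power_eq)
  have lh: "lead_coeff h = 1"
    using f(1) g(2) by (simp add: fh lead_coeff_mult lead_coeff_power)
  have ch: "coeff h 0 \<noteq> 0" using f(3) by (auto simp: fh coeff_mult_0)
  show ?thesis
  proof (cases "degree h = 0")
    case True
    then have "h = 1" using lh by (auto elim!: degree_eq_zeroE)
    then show ?thesis using fh deg g(5) by simp
  next
    case False
    have hm: "h \<in> monic_polys (degree h)" using lh ch by (simp add: monic_polys_def)
    have small: "\<not> (p \<in> irred_polys j \<and> 2 * j \<le> n \<and> p dvd h)" for p j
    proof
      assume p: "p \<in> irred_polys j \<and> 2 * j \<le> n \<and> p dvd h"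
      then have "p \<in> key_irreds n" unfolding key_irreds_iff by blast
      then show False using unique[of p] ndvd fh p by auto
    qed
    have "irreducible h"
    proof (rule ccontr)
      assume "\<not> irreducible h"
      then obtain p j where "p \<in> irred_polys j" "2 * j \<le> degree h" "p dvd h"
        using reducible_small_divisor[OF hm] False by auto
      then show False using small[of p j] deg by linarith
    qed
    then have hi: "h \<in> irred_polys (degree h)" using lh ch by (simp add: irred_polys_def)
    then have "2 * degree h > n" using small[of h "degree h"] by auto
    then have "2 * (b * k) < n" "n - b * k = degree h" using deg by linarith+
    then show ?thesis using b fh hi by (intro disjI2 exI[of _ b] exI[of _ h]) simp
  qed
qed

lemma full_coprime_family_conditions:
  fixes A :: "'a::{finite,field} poly set"
  assumes "n \<ge> 1" "A \<in> coprime_families n" "card A = card (key_irreds n :: 'a poly set)"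
  shows "contains_irreds n A \<and> contains_squares n A \<and> small_irreds_covered n A \<and> no_mixed_products n A"
proof (intro conjI)
  note ex = full_coprime_family(1)[OF assms(2,1,3)]
    and unique = full_coprime_family(2)[OF assms(2,1,3)]
    and common = coprime_family_common_divisor[OF assms(2)]
  have mem: "f \<in> monic_polys n" if "f \<in> A" for f
    using that assms(2) by (auto simp: coprime_families_def)
  have form: "k dvd n \<and> f = g ^ (n div k) \<or>
      (\<exists>b h. b \<ge> 1 \<and> 2 * (b * k) < n \<and> h \<in> irred_polys (n - b * k) \<and> f = g ^ b * h)"
    if "f \<in> A" "g \<in> irred_polys k" "2 * k \<le> n" "g dvd f" for f g k
  proof (rule single_key_divisor_form[OF mem[OF that(1)] that(2-4)])
    have "g \<in> key_irreds n" using that(2,3) by (auto simp: key_irreds_iff)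
    then show "g' = g" if "g' \<in> key_irreds n" "g' dvd f" for g'
      using unique[OF \<open>f \<in> A\<close> that(1) _ that(2) \<open>g dvd f\<close>] by blast
  qed
  show "contains_irreds n A" unfolding contains_irreds_def
  proof
    fix g :: "'a poly" assume g: "g \<in> irred_polys n"
    then obtain f where "f \<in> A" "g dvd f" using ex[of g] by (auto simp: key_irreds_iff)
    then show "g \<in> A" using monic_dvd_same_degree_eq[of g n f] mem g irred_polys_subset_monic by blast
  qed
  show "contains_squares n A" unfolding contains_squares_def
  proof (intro impI subsetI)
    fix s :: "'a poly" assume n: "even n" and "s \<in> {g ^ 2 | g. g \<in> irred_polys (n div 2)}"
    then obtain g where g: "s = g ^ 2" "g \<in> irred_polys (n div 2)" by blast
    have "g \<in> key_irreds n" using g(2) n by (auto simp: key_irreds_iff)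
    then obtain f where f: "f \<in> A" "g dvd f" using ex by blast
    \<comment> \<open>For a key of degree \<open>n/2\<close>, any \<open>b \<ge> 1\<close> already
      uses up half of the degree. This rules out the form with a cofactor and leaves
      \<open>g ^ 2\<close>.\<close>
    have "f = g ^ (n div (n div 2)) \<or> (\<exists>b \<ge> 1. 2 * (b * (n div 2)) < n)"
      using form[OF f(1) g(2) _ f(2)] by auto
    moreover have "\<not> 2 * (b * (n div 2)) < n" if "b \<ge> 1" for b
      using n that by (auto elim!: evenE)
    moreover have "n div (n div 2) = 2" using n assms(1) by (auto elim!: evenE)
    ultimately show "s \<in> A" using f g by auto
  qed
  show "small_irreds_covered n A" unfolding small_irreds_covered_def
  proof (intro allI impI ballI conjI)
    fix k and g :: "'a poly" assume k: "2 * k < n" and g: "g \<in> irred_polys k"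
    have gk: "g \<in> key_irreds n" using g k by (auto simp: key_irreds_iff intro!: exI[of _ k])
    show "\<exists>!f. f \<in> A \<and> g dvd f"
      using ex[OF gk] common irred_polysD(1)[OF g] by blast
    fix f assume f: "f \<in> A" "g dvd f"
    show "k dvd n \<and> f = g ^ (n div k) \<or>
        (\<exists>b h. 2 * (b * k) < n \<and> h \<in> irred_polys (n - b * k) \<and> f = g ^ b * h \<and>
          (\<forall>f'\<in>A. h dvd f' \<longrightarrow> f' = f))"
    proof (cases "k dvd n \<and> f = g ^ (n div k)")
      case False
      then obtain b h where bh: "2 * (b * k) < n" "h \<in> irred_polys (n - b * k)" "f = g ^ b * h"
        using form[OF f(1) g _ f(2)] k by auto
      have "f' = f" if "f' \<in> A" "h dvd f'" for f'
        using common[of f' f h] that f(1) bh irred_polysD(1)[OF bh(2)] by simp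
      then show ?thesis using bh by blast
    qed simp
  qed
  show "no_mixed_products n A" unfolding no_mixed_products_def
  proof (intro impI ballI notI)
    fix g h :: "'a poly"
    assume gh: "even n" "g \<in> irred_polys (n div 2)" "h \<in> irred_polys (n div 2)" "g \<noteq> h" "g * h \<in> A"
    then have "g \<in> key_irreds n" "h \<in> key_irreds n" by (auto simp: key_irreds_iff)
    then show False using unique[of "g * h" g h] gh by simp
  qed
qed

text \<open>The conditions restrict the factorization of each member enough to show that a common
  irreducible factor identifies the member, and that each member has only one key divisor. The
  latter gives the size by \<open>card_full_coprime_family\<close>.\<close>

lemma full_coprime_family_of_conditions:
  fixes A :: "'a::{finite,field} poly set"
  assumes "n \<ge> 1" "A \<subseteq> monic_polys n" "contains_irreds n A" "contains_squares n A"
    "small_irreds_covered n A" "no_mixed_products n A"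
  shows "A \<in> coprime_families n" "card A = card (key_irreds n :: 'a poly set)"
proof -
  have mem: "f \<in> monic_polys n" if "f \<in> A" for f using that assms(2) by blast
  have small_unique: "\<exists>!f. f \<in> A \<and> g dvd f" if "2 * k < n" "g \<in> irred_polys k" for g k
    by (rule assms(5)[unfolded small_irreds_covered_def, THEN spec, THEN mp, THEN bspec, THEN conjunct1, OF that])
  \<comment> \<open>The factor 1 lets \<open>irreducible_dvd_power_mult\<close> treat both forms
    alike.\<close>
  have small_form: "(\<exists>a. f = g ^ a * 1) \<or> (\<exists>b h. 2 * (b * k) < n \<and> h \<in> irred_polys (n - b * k) \<and>
      f = g ^ b * h \<and> (\<forall>f'\<in>A. h dvd f' \<longrightarrow> f' = f))"
    if "2 * k < n" "g \<in> irred_polys k" "f \<in> A" "g dvd f" for f g k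
    using assms(5)[unfolded small_irreds_covered_def, THEN spec, THEN mp, THEN bspec, THEN conjunct2,
      THEN bspec, THEN mp, OF that] unfolding mult_1_right by blast
  \<comment> \<open>The remaining possibility, a product of two distinct irreducibles of degree
    \<open>n/2\<close>, is what \<open>no_mixed_products\<close> excludes.\<close>
  have cases: "f \<in> irred_polys n \<or> (\<exists>k g. 2 * k = n \<and> g \<in> irred_polys k \<and> f = g ^ 2) \<or>
      (\<exists>k g. 2 * k < n \<and> g \<in> irred_polys k \<and> g dvd f)" if fA: "f \<in> A" for f
  proof (rule ccontr)
    assume neg: "\<not> ?thesis"
    note f = monic_polysD[OF mem[OF fA]]
    have "\<not> irreducible f" using neg f by (auto simp: irred_polys_def)
    then obtain g k where g: "g \<in> irred_polys k" "2 * k \<le> n" "g dvd f"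
      using reducible_small_divisor[OF mem[OF fA] assms(1)] by blast
    have k: "2 * k = n"
    proof (rule ccontr)
      assume "2 * k \<noteq> n"
      then have "2 * k < n" using g(2) by simp
      then show False using neg g(1,3) by blast
    qed
    obtain c where c: "f = g * c" using g(3) by (elim dvdE)
    note gD = irred_polysD[OF g(1)]
    have "c \<noteq> 0" using c f(4) by auto
    then have dc: "degree c = k" using f(2) gD(3,6) k by (simp add: c degree_mult_eq)
    have lc: "lead_coeff c = 1" using f(1) gD(2) by (simp add: c lead_coeff_mult)
    have cc: "coeff c 0 \<noteq> 0" using f(3) by (auto simp: c coeff_mult_0)
    have cm: "c \<in> monic_polys k" using dc lc cc by (simp add: monic_polys_def)
    have "irreducible c"
    proof (rule ccontr)
      assume "\<not> irreducible c"
      then obtain p j where p: "p \<in> irred_polys j" "2 * j \<le> k" "p dvd c"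
        using reducible_small_divisor[OF cm gD(5)] by blast
      then have "2 * j < n" "p dvd f" using k assms(1) c by auto
      then show False using neg p(1) by blast
    qed
    then have ci: "c \<in> irred_polys k" using dc lc cc by (simp add: irred_polys_def)
    have "even n" "n div 2 = k" using k by auto
    then have "g = c" using assms(6) g(1) ci fA c unfolding no_mixed_products_def by blast
    then have "f = g ^ 2" using c by (simp add: power2_eq_square)
    then show False using neg k g(1) by blast
  qed
  \<comment> \<open>Common factors of degree below \<open>n/2\<close> are governed by
    \<open>small_unique\<close>; this handles the others. In each of the three outcomes, a second
    member divisible by \<open>p\<close> turns out to be \<open>f\<close>.\<close>
  have large: "p = f \<or> f = p ^ 2 \<or> (\<forall>f'\<in>A. p dvd f' \<longrightarrow> f' = f)"
    if p: "irreducible p" "lead_coeff p = 1" "p dvd f" "n \<le> 2 * degree p" and f: "f \<in> A" for p f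
    using cases[OF f]
  proof (elim disjE exE conjE)
    assume "f \<in> irred_polys n"
    then show ?thesis using irreducible_monic_dvd_eq[OF p(1) _ p(2) _ p(3)] irred_polysD(1,2) by blast
  next
    fix k g assume "g \<in> irred_polys k" "f = g ^ 2"
    then show ?thesis
      using irreducible_dvd_power_mult[OF p(1,2), of g k 2 1] p irreducible_not_unit by auto
  next
    fix k g assume g: "2 * k < n" "g \<in> irred_polys k" "g dvd f"
    have neq: "p \<noteq> g" using g p(4) irred_polysD(3) by force
    show ?thesis using small_form[OF g(1,2) f g(3)]
    proof (elim disjE exE conjE)
      fix a assume "f = g ^ a * 1"
      then show ?thesis
        using irreducible_dvd_power_mult[OF p(1,2) g(2), of a 1] p neq irreducible_not_unit by auto
    next
      fix b h assume h: "h \<in> irred_polys (n - b * k)" "f = g ^ b * h" "\<forall>f'\<in>A. h dvd f' \<longrightarrow> f' = f"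
      have "p dvd h" using irreducible_dvd_power_mult[OF p(1,2) g(2), of b h] p(3) h(2) neq by auto
      then have "p = h" using irreducible_monic_dvd_eq[of p h] p irred_polysD(1,2)[OF h(1)] by blast
      then show ?thesis using h(3) by blast
    qed
  qed
  show fam: "A \<in> coprime_families n"
  proof -
    have "f = f'" if f: "f \<in> A" "f' \<in> A" and p: "irreducible p" "lead_coeff p = 1" "p dvd f" "p dvd f'"
      for f f' p
    proof (cases "2 * degree p < n")
      case True
      then show ?thesis
        using small_unique[OF True irreducible_dvd_monic_poly[OF p(1-3) mem[OF f(1)]]] f p by blast
    next
      case False
      then have le: "n \<le> 2 * degree p" by simp
      have "p = f \<Longrightarrow> f = f'" "p = f' \<Longrightarrow> f = f'"
        using monic_dvd_same_degree_eq[OF mem[OF f(1)] mem[OF f(2)]]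
          monic_dvd_same_degree_eq[OF mem[OF f(2)] mem[OF f(1)]] p by auto
      then show ?thesis using large[OF p(1,2,3) le f(1)] large[OF p(1,2,4) le f(2)] f p by blast
    qed
    then have "coprime f f'" if "f \<in> A" "f' \<in> A" "f \<noteq> f'" for f f'
      using that coprime_iff_no_common_irreducible[OF monic_polysD(4)[OF mem[OF that(1)]]] by blast
    then show ?thesis using assms(2) by (auto simp: coprime_families_def pairwise_def)
  qed
  show "card A = card (key_irreds n :: 'a poly set)"
  proof (rule card_full_coprime_family[OF fam assms(1)])
    fix g :: "'a poly" assume "g \<in> key_irreds n"
    then consider "g \<in> irred_polys n" | k where "2 * k = n" "g \<in> irred_polys k"
      | k where "2 * k < n" "g \<in> irred_polys k"
      unfolding key_irreds_iff using le_neq_implies_less by blast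
    then show "\<exists>f\<in>A. g dvd f"
    proof cases
      case 1
      then have "g \<in> A" using assms(3) unfolding contains_irreds_def by blast
      then show ?thesis by (intro bexI[of _ g]) simp_all
    next
      case (2 k)
      then have "g ^ 2 \<in> A" using assms(4) unfolding contains_squares_def by fastforce
      then show ?thesis by (intro bexI[of _ "g ^ 2"]) (auto simp: power2_eq_square)
    next
      case (3 k)
      then show ?thesis using small_unique[OF 3] by blast
    qed
  next
    fix f g g' :: "'a poly"
    assume f: "f \<in> A" and g: "g \<in> key_irreds n" "g' \<in> key_irreds n" "g dvd f" "g' dvd f"
    have "\<exists>p. \<forall>g\<in>key_irreds n. g dvd f \<longrightarrow> g = p"
      using cases[OF f]
    proof (elim disjE exE conjE)
      assume "f \<in> irred_polys n"
      then have "g = f" if "g \<in> key_irreds n" "g dvd f" for g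
        using irreducible_monic_dvd_eq[of g f] irred_polysD(1,2) key_irreds_irred[OF that(1)] that(2) by blast
      then show ?thesis by blast
    next
      fix k p assume "p \<in> irred_polys k" "f = p ^ 2"
      then have "g = p" if "g \<in> key_irreds n" "g dvd f" for g
        using irreducible_dvd_power_mult[of g p k 2 1] that irreducible_not_unit
          irred_polysD(1,2)[OF key_irreds_irred[OF that(1)]] by auto
      then show ?thesis by blast
    next
      fix k p assume p: "2 * k < n" "p \<in> irred_polys k" "p dvd f"
      show ?thesis using small_form[OF p(1,2) f p(3)]
      proof (elim disjE exE conjE)
        fix a assume "f = p ^ a * 1"
        then have "g = p" if "g \<in> key_irreds n" "g dvd f" for g
          using irreducible_dvd_power_mult[OF _ _ p(2), of g a 1] that irreducible_not_unit
            irred_polysD(1,2)[OF key_irreds_irred[OF that(1)]] by auto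
        then show ?thesis by blast
      next
        fix b h assume h: "2 * (b * k) < n" "h \<in> irred_polys (n - b * k)" "f = p ^ b * h"
        \<comment> \<open>The covering condition itself admits \<open>b = 0\<close>. Then
          \<open>f = h\<close> would be irreducible of degree \<open>n\<close>, yet divisible by
          \<open>p\<close> of smaller degree.\<close>
        have b: "b \<noteq> 0"
        proof
          assume "b = 0"
          then have "p = h" "degree h = n"
            using h p(3) irreducible_monic_dvd_eq[of p h] irred_polysD(1,2,3) p(2) by auto
          then show False using p(1) irred_polysD(3)[OF p(2)] by simp
        qed
        \<comment> \<open>A second key would have to be \<open>h\<close>, but the degree
          \<open>n - b * k\<close> of \<open>h\<close> lies strictly between \<open>n/2\<close> and
          \<open>n\<close>.\<close>
        have "g = p" if "g \<in> key_irreds n" "g dvd f" for g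
        proof (rule ccontr)
          note gi = key_irreds_irred[OF that(1)]
          assume "g \<noteq> p"
          then have "g dvd h"
            using irreducible_dvd_power_mult[OF irred_polysD(1,2)[OF gi] p(2), of b h] that(2) h(3) by auto
          then have "g = h" using irreducible_monic_dvd_eq[of g h] irred_polysD(1,2) gi h(2) by blast
          then have "degree g = n - b * k" using irred_polysD(3)[OF h(2)] by simp
          moreover have "degree g = n \<or> 2 * degree g \<le> n"
            using that(1) by (auto simp: key_irreds_iff irred_polys_def)
          moreover have "b * k > 0" using b irred_polysD(5)[OF p(2)] by simp
          ultimately show False using h(1) by linarith
        qed
        then show ?thesis by blast
      qed
    qed
    then show "g = g'" using g by blast
  qed
qed

lemma max_families_iff:
  fixes A :: "'a::{finite,field} poly set"
  assumes "n \<ge> 1" "A \<subseteq> monic_polys n"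
  shows "A \<in> max_families n \<longleftrightarrow>
    contains_irreds n A \<and> contains_squares n A \<and> small_irreds_covered n A \<and> no_mixed_products n A"
proof
  assume "A \<in> max_families n"
  then show "contains_irreds n A \<and> contains_squares n A \<and> small_irreds_covered n A \<and> no_mixed_products n A"
    using full_coprime_family_conditions[OF assms(1), of A] max_coprime_eq[OF assms(1), where 'a='a]
    by (simp add: max_families_def)
next
  assume "contains_irreds n A \<and> contains_squares n A \<and> small_irreds_covered n A \<and> no_mixed_products n A"
  then show "A \<in> max_families n"
    using full_coprime_family_of_conditions[OF assms] max_coprime_eq[OF assms(1), where 'a='a]
    by (simp add: max_families_def)
qed

section \<open>Squares of linear cellular automata\<close>

text \<open>A configuration \<^term>\<open>z\<close> is viewed as the linear functional sending \<open>X\<^sup>i\<close> to \<open>z\<^sub>i\<close>.\<close>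

definition pairing :: "'a::field list \<Rightarrow> 'a poly \<Rightarrow> 'a" where
  "pairing z p = (\<Sum>i<length z. coeff p i * z ! i)"

lemma pairing_add: "pairing z (p + q) = pairing z p + pairing z q"
  by (simp add: pairing_def distrib_right sum.distrib)

lemma pairing_sum: "pairing z (sum f A) = (\<Sum>x\<in>A. pairing z (f x))"
  by (simp add: pairing_def coeff_sum sum_distrib_right sum.swap[of _ A])

lemma nth_ca_map_linear_rule:
  assumes "length as = n + 1" "i + n < length z"
  shows "ca_map n (linear_rule as) z ! i = (\<Sum>j\<le>n. as ! j * z ! (i + j))"
proof -
  have "ca_map n (linear_rule as) z ! i = linear_rule as (take (n + 1) (drop i z))"
  proof -
    have "i < length z - n" using assms(2) by simp
    then show ?thesis by (simp add: ca_map_def)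
  qed
  also have "\<dots> = (\<Sum>j\<le>n. as ! j * z ! (i + j))"
    unfolding linear_rule_def assms(1) using assms(2)
    by (intro sum.cong) auto
  finally show ?thesis .
qed

text \<open>Multiplying by \<open>X^i\<close> shifts the rule coefficients to the positions
  \<open>i..i + n\<close> that output cell \<open>i\<close> reads. The bound on \<open>i\<close>
  keeps them inside \<open>z\<close>, beyond which \<open>pairing\<close> ignores
  coefficients.\<close>

lemma pairing_monom_mult:
  assumes "length as = n + 1" "i + n < length z"
  shows "pairing z (monom c i * Poly as) = c * ca_map n (linear_rule as) z ! i"
proof -
  have "pairing z (monom c i * Poly as) = (\<Sum>k\<in>{i..i + n}. c * as ! (k - i) * z ! k)"
    unfolding pairing_def
    by (rule sum.mono_neutral_cong_right) (use assms in \<open>auto simp: coeff_monom_mult nth_default_def\<close>)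
  also have "\<dots> = (\<Sum>j\<le>n. c * as ! j * z ! (i + j))"
    by (rule sum.reindex_bij_witness[of _ "\<lambda>j. i + j" "\<lambda>k. k - i"]) auto
  finally show ?thesis
    using assms by (simp add: nth_ca_map_linear_rule sum_distrib_left mult.assoc)
qed

text \<open>A configuration of length \<open>2 * n\<close> has \<open>n\<close> output cells, so the
  multiples of the rule polynomial by polynomials of degree below \<open>n\<close> are the ones
  whose pairing is a combination of outputs.\<close>

lemma pairing_mult_rule:
  assumes "length as = n + 1" "length z = 2 * n" "degree a < n"
  shows "pairing z (a * Poly as) = (\<Sum>i<n. coeff a i * ca_map n (linear_rule as) z ! i)"
proof -
  have "a = (\<Sum>i\<le>n - 1. monom (coeff a i) i)"
    using assms(3) by (intro poly_as_sum_of_monoms'[symmetric]) simp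
  also have "{..n - 1} = {..<n}" using assms(3) by auto
  finally have "a * Poly as = (\<Sum>i<n. monom (coeff a i) i * Poly as)"
    by (simp only: sum_distrib_right[symmetric])
  then have "pairing z (a * Poly as) = (\<Sum>i<n. pairing z (monom (coeff a i) i * Poly as))"
    by (simp only: pairing_sum)
  also have "\<dots> = (\<Sum>i<n. coeff a i * ca_map n (linear_rule as) z ! i)"
    using assms by (intro sum.cong refl pairing_monom_mult) auto
  finally show ?thesis .
qed

section \<open>Joint injectivity, orthogonality and the Latin property\<close>

lemma coeff_Poly_nth: "length as = n + 1 \<Longrightarrow> coeff (Poly as) i = (if i \<le> n then as ! i else 0)"
  by (auto simp: nth_default_def)

lemma degree_Poly_eq: "length as = n + 1 \<Longrightarrow> as ! n \<noteq> 0 \<Longrightarrow> degree (Poly as) = n"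
  by (rule antisym) (auto intro!: degree_le le_degree simp: coeff_Poly_nth simp del: coeff_Poly_eq)

lemma degree_Poly_le: "length as = n + 1 \<Longrightarrow> degree (Poly as) \<le> n"
  by (auto intro!: degree_le simp: coeff_Poly_nth simp del: coeff_Poly_eq)

text \<open>Multiply a Bezout identity by \<open>p\<close>, reduce the coefficient of
  \<open>g\<close> modulo \<open>f\<close> and move the quotient to the coefficient of
  \<open>f\<close>; the degree of \<open>a\<close> is then forced. Allowing
  \<open>degree g < n\<close> admits the constant rule polynomial 1 used for the Latin
  property.\<close>

lemma coprime_combination_degree:
  fixes f g p :: "'a::field poly"
  assumes "coprime f g" "degree f = n" "n \<ge> 1" "degree g \<le> n" "degree p < 2 * n"
  obtains a b where "p = a * f + b * g" "degree a < n" "degree b < n"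
proof -
  obtain u v where uv: "u * f + v * g = 1" using bezout_coprime_poly[OF assms(1)] .
  have f0: "f \<noteq> 0" using assms by auto
  define b where "b = (p * v) mod f"
  define c where "c = (p * v) div f"
  define a where "a = p * u + c * g"
  have "p = p * (u * f + v * g)" using uv by simp
  also have "\<dots> = p * (u * f) + (p * v) * g" by (simp add: algebra_simps)
  also have "p * v = c * f + b" by (simp add: b_def c_def)
  also have "p * (u * f) + (c * f + b) * g = a * f + b * g" by (simp add: a_def algebra_simps)
  finally have eq: "p = a * f + b * g" .
  have db: "degree b < n"
    using degree_mod_less[OF f0, of "p * v"] assms(2,3) by (auto simp: b_def)
  have "degree (b * g) < 2 * n" using degree_mult_le[of b g] db assms(4) by linarith
  then have "degree (p - b * g) < 2 * n" using assms(5) by (intro degree_diff_less)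
  then have "degree (a * f) < 2 * n" using eq by simp
  then have "degree a < n" using assms(2,3) f0 by (cases "a = 0") (simp_all add: degree_mult_eq)
  with eq db show thesis using that by blast
qed

text \<open>Each \<open>X^i\<close> with \<open>i < 2 * n\<close> is a combination of the two rule
  polynomials with coefficients of degree below \<open>n\<close>, so the cell \<open>z ! i\<close>
  can be computed from the two outputs.\<close>

lemma ca_maps_jointly_injective:
  fixes as bs z z' :: "'a::field list"
  assumes "length as = n + 1" "length bs = n + 1" "as ! n \<noteq> 0" "coprime (Poly as) (Poly bs)"
    and "length z = 2 * n" "length z' = 2 * n"
    and eq: "ca_map n (linear_rule as) z = ca_map n (linear_rule as) z'"
      "ca_map n (linear_rule bs) z = ca_map n (linear_rule bs) z'"
  shows "z = z'"
proof (cases "n = 0")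
  case False
  show ?thesis
  proof (rule nth_equalityI)
    fix i assume i: "i < length z"
    have "degree (monom (1::'a) i) < 2 * n" using i assms(5) by (simp add: degree_monom_eq)
    then obtain a b where ab: "monom 1 i = a * Poly as + b * Poly bs" "degree a < n" "degree b < n"
      using coprime_combination_degree[OF assms(4) degree_Poly_eq[OF assms(1,3)] _ degree_Poly_le[OF assms(2)]]
        False by (metis One_nat_def Suc_leI neq0_conv)
    have "pairing z (monom 1 i) = pairing z' (monom 1 i)"
      unfolding ab(1) pairing_add using assms ab by (simp add: pairing_mult_rule)
    moreover have "pairing y (monom 1 i) = y ! i" if "length y = 2 * n" for y :: "'a list"
    proof -
      have "pairing y (monom 1 i) = (\<Sum>j<2 * n. if j = i then y ! j else 0)"
        unfolding pairing_def that by (intro sum.cong) auto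
      then show ?thesis using i assms(5) by simp
    qed
    ultimately show "z ! i = z' ! i" using assms(5,6) by simp
  qed (use assms in simp)
qed (use assms in simp)

lemma vecs_append: "x \<in> vecs n \<Longrightarrow> y \<in> vecs n \<Longrightarrow> length (x @ y) = 2 * n"
  by (simp add: vecs_def)

lemma finite_vecs [simp]: "finite (vecs n :: 'a::finite list set)"
  using finite_lists_length_eq[of "UNIV :: 'a set" n] by (simp add: vecs_def)

lemma ca_square_apply: "x \<in> vecs n \<Longrightarrow> y \<in> vecs n \<Longrightarrow> ca_square n f (x, y) = ca_map n f (x @ y)"
  by (simp add: ca_square_def)

lemma ca_square_in_vecs: "x \<in> vecs n \<Longrightarrow> y \<in> vecs n \<Longrightarrow> ca_square n f (x, y) \<in> vecs n"
  by (simp add: ca_square_apply) (simp add: vecs_def ca_map_def)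

lemma ca_squares_jointly_injective:
  fixes as bs :: "'a::field list"
  assumes "length as = n + 1" "length bs = n + 1" "as ! n \<noteq> 0" "coprime (Poly as) (Poly bs)"
    and "x \<in> vecs n" "y \<in> vecs n" "x' \<in> vecs n" "y' \<in> vecs n"
    and "ca_square n (linear_rule as) (x, y) = ca_square n (linear_rule as) (x', y')"
    and "ca_square n (linear_rule bs) (x, y) = ca_square n (linear_rule bs) (x', y')"
  shows "x = x' \<and> y = y'"
proof -
  have "x @ y = x' @ y'"
    by (rule ca_maps_jointly_injective[OF assms(1-4)])
      (use assms(5-10) in \<open>simp_all add: vecs_append ca_square_apply del: length_append\<close>)
  then show ?thesis using assms(5,7) by (simp add: vecs_def)
qed

text \<open>If the polynomials are coprime, joint injectivity suffices, the domain being finite. If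
  they have a common factor, dividing it out gives a nontrivial linear relation between the two
  outputs, so the joint map is not onto.\<close>

lemma orthogonal_ca_squares_iff:
  fixes as bs :: "'a::{finite,field} list"
  assumes "n \<ge> 1" "length as = n + 1" "length bs = n + 1" "as ! n \<noteq> 0" "bs ! n \<noteq> 0"
  shows "orthogonal_squares (vecs n) (ca_square n (linear_rule as)) (ca_square n (linear_rule bs))
    \<longleftrightarrow> coprime (Poly as) (Poly bs)"
proof
  let ?F = "\<lambda>p. (ca_square n (linear_rule as) p, ca_square n (linear_rule bs) p)"
  let ?V = "vecs n :: 'a list set"
  assume cop: "coprime (Poly as) (Poly bs)"
  have "inj_on ?F (?V \<times> ?V)"
  proof (rule inj_onI)
    fix p p' assume "p \<in> ?V \<times> ?V" "p' \<in> ?V \<times> ?V" "?F p = ?F p'"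
    then show "p = p'"
      using ca_squares_jointly_injective[OF assms(2,3,4) cop, of "fst p" "snd p" "fst p'" "snd p'"]
      by (auto simp: mem_Times_iff prod_eq_iff)
  qed
  moreover have "?F ` (?V \<times> ?V) \<subseteq> ?V \<times> ?V" by (auto intro: ca_square_in_vecs)
  ultimately show "orthogonal_squares ?V (ca_square n (linear_rule as)) (ca_square n (linear_rule bs))"
    unfolding orthogonal_squares_def bij_betw_def by (simp add: endo_inj_surj)
next
  let ?F = "\<lambda>p. (ca_square n (linear_rule as) p, ca_square n (linear_rule bs) p)"
  let ?V = "vecs n :: 'a list set"
  assume "orthogonal_squares ?V (ca_square n (linear_rule as)) (ca_square n (linear_rule bs))"
  then have surj: "?F ` (?V \<times> ?V) = ?V \<times> ?V"
    unfolding orthogonal_squares_def by (rule bij_betw_imp_surj_on)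
  show "coprime (Poly as) (Poly bs)"
  proof (rule ccontr)
    note df = degree_Poly_eq[OF assms(2,4)] and dg = degree_Poly_eq[OF assms(3,5)]
    have nz: "Poly as \<noteq> 0" "Poly bs \<noteq> 0" using df dg assms(1) by auto
    assume "\<not> coprime (Poly as) (Poly bs)"
    then obtain d where d: "d dvd Poly as" "d dvd Poly bs" "\<not> is_unit d" by (auto elim: not_coprimeE)
    then obtain f g where f: "Poly as = d * f" and g: "Poly bs = d * g" by (auto elim!: dvdE)
    have nz': "d \<noteq> 0" "f \<noteq> 0" "g \<noteq> 0" using nz f g by auto
    then have "degree d > 0" using d(3) is_unit_iff_degree by blast
    then have deg: "degree f < n" "degree g < n"
      using df dg nz' by (simp_all add: f g degree_mult_eq)
    \<comment> \<open>The pair of the unit vector \<open>u\<close> at position \<open>k\<close> and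
      the zero vector violates the relation: it would give \<open>coeff g k\<close> on one side and
      0 on the other.\<close>
    obtain k where k: "k < n" "coeff g k \<noteq> 0"
      using nz'(3) deg(2) leading_coeff_0_iff by blast
    define u :: "'a list" where "u = map (\<lambda>i. if i = k then 1 else 0) [0..<n]"
    have "(u, replicate n 0) \<in> ?V \<times> ?V" by (simp add: vecs_def u_def)
    then have "(u, replicate n 0) \<in> ?F ` (?V \<times> ?V)" by (simp only: surj)
    then obtain x y where xy: "x \<in> ?V" "y \<in> ?V"
      "ca_square n (linear_rule as) (x, y) = u" "ca_square n (linear_rule bs) (x, y) = replicate n 0" by auto
    let ?z = "x @ y"
    have len: "length ?z = 2 * n" using xy by (intro vecs_append)
    have "pairing ?z (g * Poly as) = (\<Sum>i<n. coeff g i * u ! i)"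
      using pairing_mult_rule[OF assms(2) len deg(2)] xy by (simp add: ca_square_apply)
    also have "\<dots> = coeff g k"
      using k(1) by (simp add: u_def if_distrib cong: if_cong)
    finally have "pairing ?z (g * Poly as) \<noteq> 0" using k by simp
    moreover have "pairing ?z (f * Poly bs) = 0"
      using pairing_mult_rule[OF assms(3) len deg(1)] xy by (simp add: ca_square_apply)
    moreover have "g * Poly as = f * Poly bs" by (simp add: f g)
    ultimately show False by simp
  qed
qed

text \<open>The rules with polynomials \<open>1\<close> and \<open>X\<^sup>n\<close> return the left and the right input, so coprimality
  with them gives bijectivity in each argument.\<close>

lemma ca_square_latin:
  fixes as :: "'a::{finite,field} list"
  assumes "n \<ge> 1" "length as = n + 1" "as ! 0 \<noteq> 0" "as ! n \<noteq> 0"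
  shows "latin_square (vecs n) (ca_square n (linear_rule as))"
proof -
  let ?V = "vecs n :: 'a list set" and ?L = "ca_square n (linear_rule as)"
  define e where "e = (\<lambda>k. map (\<lambda>i. if i = k then 1 else 0 :: 'a) [0..<n + 1])"
  have len: "length (e k) = n + 1" for k by (simp add: e_def)
  have e_nth: "e k ! j = (if j = k then 1 else 0)" if "j \<le> n" for j k
    using that by (simp add: e_def nth_append less_Suc_eq_le del: upt_Suc)
  have Poly_e: "Poly (e k) = monom 1 k" if "k \<le> n" for k
    using that by (intro poly_eqI) (auto simp: coeff_Poly_nth[OF len] e_nth simp del: coeff_Poly_eq)
  have nth_e: "ca_map n (linear_rule (e k)) z ! i = z ! (i + k)" if "i + n < length z" "k \<le> n" for i k z
  proof -
    have "(\<Sum>j\<le>n. e k ! j * z ! (i + j)) = (\<Sum>j\<le>n. if j = k then z ! (i + j) else 0)"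
      by (intro sum.cong) (auto simp: e_nth)
    then show ?thesis using that by (simp add: nth_ca_map_linear_rule[OF len])
  qed
  have left: "ca_square n (linear_rule (e 0)) (x, y) = x" if "x \<in> ?V" "y \<in> ?V" for x y
    using that vecs_append[OF that] ca_square_in_vecs[OF that, of "linear_rule (e 0)"]
    by (intro nth_equalityI) (auto simp: ca_square_apply nth_e nth_append vecs_def)
  have right: "ca_square n (linear_rule (e n)) (x, y) = y" if "x \<in> ?V" "y \<in> ?V" for x y
    using that vecs_append[OF that] ca_square_in_vecs[OF that, of "linear_rule (e n)"]
    by (intro nth_equalityI) (auto simp: ca_square_apply nth_e nth_append vecs_def)
  have coprime_left: "coprime (Poly as) (Poly (e 0))" by (simp add: Poly_e)
  have coprime_right: "coprime (Poly as) (Poly (e n))"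
  proof -
    have "\<not> [:0, 1:] dvd Poly as"
      using poly_eq_0_iff_dvd[of "Poly as" 0] assms(2,3)
      by (simp add: poly_0_coeff_0 nth_default_def)
    moreover have "prime_elem [:0, 1 :: 'a:]" by (rule prime_elem_linear_field_poly) simp
    ultimately have "p dvd Poly as \<Longrightarrow> \<not> [:0, 1:] dvd p" for p by (meson dvd_trans)
    moreover have "irreducible p \<Longrightarrow> p dvd [:0, 1:] ^ n \<Longrightarrow> [:0, 1:] dvd p" for p :: "'a poly"
      using prime_elem_dvd_power[OF field_poly_irreducible_imp_prime, of p "[:0, 1:]" n]
        irreducible_linear_field_poly[of 1 0] irreducibleD'[of "[:0, 1:]" p] irreducible_not_unit by auto
    moreover have "Poly as \<noteq> 0" using degree_Poly_eq[OF assms(2,4)] assms(1) by auto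
    ultimately have "coprime (Poly as) ([:0, 1:] ^ n)"
      by (subst coprime_iff_no_common_irreducible) blast+
    then show ?thesis by (simp add: Poly_e monom_altdef)
  qed
  have "bij_betw (\<lambda>y. ?L (x, y)) ?V ?V" if x: "x \<in> ?V" for x
  proof -
    \<comment> \<open>Inputs with the same \<open>x\<close> also agree under the rule
      \<open>e 0\<close>, so joint injectivity separates them by \<open>?L\<close> alone.\<close>
    have "inj_on (\<lambda>y. ?L (x, y)) ?V"
      using ca_squares_jointly_injective[OF assms(2) len assms(4) coprime_left x _ x] x
      by (intro inj_onI) (simp add: left)
    moreover have "(\<lambda>y. ?L (x, y)) ` ?V \<subseteq> ?V" using x by (auto intro: ca_square_in_vecs)
    ultimately show ?thesis by (simp add: bij_betw_def endo_inj_surj)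
  qed
  moreover have "bij_betw (\<lambda>x. ?L (x, y)) ?V ?V" if y: "y \<in> ?V" for y
  proof -
    have "inj_on (\<lambda>x. ?L (x, y)) ?V"
      using ca_squares_jointly_injective[OF assms(2) len assms(4) coprime_right _ y _ y] y
      by (intro inj_onI) (simp add: right)
    moreover have "(\<lambda>x. ?L (x, y)) ` ?V \<subseteq> ?V" using y by (auto intro: ca_square_in_vecs)
    ultimately show ?thesis by (simp add: bij_betw_def endo_inj_surj)
  qed
  ultimately show ?thesis by (simp add: latin_square_def)
qed

section \<open>Orthogonal sets of squares and coprime families\<close>

lemma coprime_self_degree: "coprime p p \<Longrightarrow> degree p = 0" for p :: "'a::field poly"
  using is_unit_iff_degree[of p] by (cases "p = 0") auto

text \<open>The same cardinalities occur on both sides, so the maxima agree and finiteness of the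
  sets of squares need not be shown separately.\<close>

lemma max_linear_ca_mols_eq:
  assumes "n \<ge> 1"
  shows "max_linear_ca_mols TYPE('a::{finite,field}) n = max_coprime TYPE('a) n"
proof -
  let ?sq = "\<lambda>as :: 'a list. ca_square n (linear_rule as)"
  let ?ok = "\<lambda>as :: 'a list. length as = n + 1 \<and> as ! 0 \<noteq> 0 \<and> as ! n \<noteq> 0"
  let ?M = "{\<L>. \<L> \<subseteq> (linear_bipermutive_squares n :: ('a list \<times> 'a list \<Rightarrow> 'a list) set) \<and> mols (vecs n) \<L>}"
  have ortho: "orthogonal_squares (vecs n) (?sq as) (?sq bs) \<longleftrightarrow> coprime (Poly as) (Poly bs)"
    if "?ok as" "?ok bs" for as bs
    using that assms by (intro orthogonal_ca_squares_iff) auto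
  have "card ` ?M = card ` (coprime_families n :: 'a poly set set)"
  proof (intro equalityI image_subsetI)
    fix \<L> assume L: "\<L> \<in> ?M"
    then have "\<forall>L\<in>\<L>. \<exists>as. L = ?sq as \<and> ?ok as" unfolding linear_bipermutive_squares_def by blast
    then obtain r where r: "\<And>L. L \<in> \<L> \<Longrightarrow> L = ?sq (r L)" "\<And>L. L \<in> \<L> \<Longrightarrow> ?ok (r L)" by metis
    \<comment> \<open>Scaling to leading coefficient 1 lands in \<open>monic_polys n\<close> and
      preserves coprimality.\<close>
    define p where "p L = smult (inverse (r L ! n)) (Poly (r L))" for L
    have cop: "coprime (p L) (p L')" if "L \<in> \<L>" "L' \<in> \<L>" "L \<noteq> L'" for L L'
    proof -
      have "orthogonal_squares (vecs n) L L'" using L that by (auto simp: mols_def pairwise_def)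
      then have "coprime (Poly (r L)) (Poly (r L'))" using ortho[of "r L" "r L'"] r that by metis
      moreover have "p L dvd Poly (r L)" "p L' dvd Poly (r L')"
        using r(2) that by (auto simp: p_def smult_dvd_iff)
      ultimately show ?thesis by (meson coprime_divisors)
    qed
    have deg: "degree (p L) = n" if "L \<in> \<L>" for L
      using r(2)[OF that] by (simp add: p_def degree_Poly_eq)
    have mem: "p L \<in> monic_polys n" if "L \<in> \<L>" for L
      using r(2)[OF that] deg[OF that]
      by (auto simp: monic_polys_def p_def coeff_Poly_nth simp del: coeff_Poly_eq)
    have "inj_on p \<L>"
    proof (rule inj_onI, rule ccontr)
      fix L L' assume "L \<in> \<L>" "L' \<in> \<L>" "p L = p L'" "L \<noteq> L'"
      then show False using cop[of L L'] coprime_self_degree[of "p L"] deg[of L] assms by simp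
    qed
    then have "card \<L> = card (p ` \<L>)" by (simp add: card_image)
    moreover have "p ` \<L> \<in> coprime_families n"
      using mem cop by (auto simp: coprime_families_def pairwise_def)
    ultimately show "card \<L> \<in> card ` (coprime_families n :: 'a poly set set)" by (metis imageI)
  next
    fix R :: "'a poly set" assume R: "R \<in> coprime_families n"
    define s where "s p = ?sq (coeffs p)" for p
    have ok: "?ok (coeffs p)" "degree p = n" if "p \<in> R" for p
    proof -
      have p: "degree p = n" "lead_coeff p = 1" "coeff p 0 \<noteq> 0"
        using that R by (auto simp: coprime_families_def monic_polys_def)
      then have "p \<noteq> 0" by auto
      with p show "?ok (coeffs p)" "degree p = n" by (simp_all add: length_coeffs coeffs_nth)
    qed
    have orth: "orthogonal_squares (vecs n) (s p) (s p')" if "p \<in> R" "p' \<in> R" "p \<noteq> p'" for p p'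
      using ortho[OF ok(1) ok(1), OF that(1,2)] that R
      by (simp add: s_def coprime_families_def pairwise_def)
    \<comment> \<open>If two distinct polynomials gave the same square, that square would be
      orthogonal to itself and a polynomial of degree \<open>n \<ge> 1\<close> coprime to
      itself.\<close>
    have inj: "inj_on s R"
    proof (rule inj_onI, rule ccontr)
      fix p p' assume p: "p \<in> R" "p' \<in> R" "s p = s p'" "p \<noteq> p'"
      then have "orthogonal_squares (vecs n) (s p) (s p)" using orth by metis
      then have "coprime p p" using ortho[OF ok(1) ok(1), OF p(1,1)] by (simp add: s_def)
      then show False using coprime_self_degree[of p] ok(2)[OF p(1)] assms by simp
    qed
    have "s p \<in> linear_bipermutive_squares n" if "p \<in> R" for p
      unfolding linear_bipermutive_squares_def s_def using ok(1)[OF that] by blast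
    moreover have "latin_square (vecs n) (s p)" if "p \<in> R" for p
      unfolding s_def using ca_square_latin[OF assms] ok(1)[OF that] by blast
    moreover have "pairwise (orthogonal_squares (vecs n)) (s ` R)"
      using orth unfolding pairwise_def by blast
    ultimately have "s ` R \<in> ?M" by (simp add: mols_def image_subset_iff)
    moreover have "card R = card (s ` R)" using inj by (simp add: card_image)
    ultimately show "card R \<in> card ` ?M" by (simp only: imageI)
  qed
  then show ?thesis by (simp add: max_linear_ca_mols_def max_coprime_def)
qed

theorem theorem3:
  fixes n :: nat
  assumes "n \<ge> 1"
  shows "max_coprime TYPE('a::{finite, field}) n =
           card (irred_polys n :: 'a poly set) + (\<Sum>k = 1..n div 2. card (irred_polys k :: 'a poly set))
       \<and> max_linear_ca_mols TYPE('a) n = max_coprime TYPE('a) n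
       \<and> (\<forall>A. A \<subseteq> (monic_polys n :: 'a poly set) \<longrightarrow>
            (A \<in> max_families n \<longleftrightarrow>
               contains_irreds n A \<and> contains_squares n A \<and> small_irreds_covered n A \<and>
               no_mixed_products n A))"
  using max_coprime_eq[OF assms, where 'a='a] card_key_irreds[OF assms, where 'a='a]
    max_linear_ca_mols_eq[OF assms, where 'a='a] max_families_iff[OF assms, where 'a='a]
  by auto

end
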